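(* Suppose that $0<\alpha<\frac12$ and $k_1\le k\le c\min\{p^{\gamma},\frac{n}{\log p}\}$ for some constants $c>0$ and $0\le\gamma<\frac12$. Let $\xi$ belong to the dense loading regime, that is, $\xi\in\Xi(q,\bar c)$ with $q=c_q\,p^{\gamma_q}$ for a constant $c_q>0$ and $2\gamma<\gamma_q\le1$. Then, for some constant $c_1>0$, $$L^*_\alpha\big(\Theta(k_1),\Theta(k),\xi^{\intercal}\beta\big)\ge c_1\,\|\xi\|_\infty\,k\sqrt{\frac{\log p}{n}}.$$
   Context: Model: one observes $Z=(Z_1,\dots,Z_n)$ with $Z_i=(y_i,X_{i\cdot})\in\mathbb{R}^{p+1}$, $y=X\beta+\epsilon$, where $X\in\mathbb{R}^{n\times p}$ has i.i.d. rows $X_{i\cdot}\sim N_p(0,\Sigma)$, independent of $\epsilon\sim N_n(0,\sigma^2\mathrm{I})$; $\Sigma$ and $\sigma$ are unknown. Let $\Omega=\Sigma^{-1}$ and $\theta=(\beta,\Omega,\sigma)$; $\mathbb{P}_\theta,\mathbb{E}_\theta$ are the corresponding probability and expectation. $\|x\|_0$ is the number of nonzero entries of $x$, $\mathrm{supp}(x)$ the set of their indices, $\|x\|_\infty=\max_j|x_j|$. Parameter space: $\Theta(k)=\{(\beta,\Omega,\sigma):\|\beta\|_0\le k,\ \frac1{M_1}\le\lambda_{\min}(\Omega)\le\lambda_{\max}(\Omega)\le M_1,\ 0<\sigma\le M_2\}$, where $M_1>1$ and $M_2>0$ are constants. Loadings: $\Xi(q,\bar c)=\{\xi\in\mathbb{R}^p:\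 \|\xi\|_0=q,\ \xi\ne 0,\ \max_{j\in\mathrm{supp}(\xi)}|\xi_j|\,/\min_{j\in\mathrm{supp}(\xi)}|\xi_j|\le\bar c\}$, where $\bar c\ge1$ is a constant. Confidence intervals: for a parameter space $\Theta$ and functional $\mathrm{T}$ of $\beta$, $\mathcal{I}_\alpha(\Theta,\mathrm{T})$ is the set of all intervals $\mathrm{CI}=[l(Z),u(Z)]$ with $\inf_{\theta\in\Theta}\mathbb{P}_\theta(l(Z)\le\mathrm{T}(\beta)\le u(Z))\ge1-\alpha$; the length is $L(\mathrm{CI})=u(Z)-l(Z)$. For $\Theta_1\subseteq\Theta$, $L^*_\alpha(\Theta_1,\Theta,\mathrm{T})=\inf_{\mathrm{CI}\in\mathcal{I}_\alpha(\Theta,\mathrm{T})}\sup_{\theta\in\Theta_1}\mathbb{E}_\theta L(\mathrm{CI})$. *)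

theory Defs
  imports "HOL-Probability.Probability" "Jordan_Normal_Form.Spectral_Radius"
    "Jordan_Normal_Form.Gauss_Jordan_Elimination"
begin

text \<open>
  The dimensions \<open>n\<close> and \<open>p\<close> vary inside the statement, so \<open>R^m\<close> is represented by the
  extensional functions \<open>{..<m} \<rightarrow>\<^sub>E UNIV\<close>, the underlying set of the product measurable space
  \<open>\<Pi>\<^sub>M i\<in>{..<m}. borel\<close>. Matrices are those of \<open>Jordan_Normal_Form\<close>.
\<close>

abbreviation Rn :: "nat \<Rightarrow> (nat \<Rightarrow> real) set" where
  "Rn m \<equiv> {..<m} \<rightarrow>\<^sub>E UNIV"

definition dotp :: "nat \<Rightarrow> (nat \<Rightarrow> real) \<Rightarrow> (nat \<Rightarrow> real) \<Rightarrow> real" where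
  "dotp m x y = (\<Sum>j<m. x j * y j)"

definition supp :: "nat \<Rightarrow> (nat \<Rightarrow> real) \<Rightarrow> nat set" where
  "supp m x = {j. j < m \<and> x j \<noteq> 0}"

definition norm0 :: "nat \<Rightarrow> (nat \<Rightarrow> real) \<Rightarrow> nat" where
  "norm0 m x = card (supp m x)"

text \<open>For \<open>m \<ge> 1\<close>; the maximum of the empty set is unspecified.\<close>

definition norm_inf :: "nat \<Rightarrow> (nat \<Rightarrow> real) \<Rightarrow> real" where
  "norm_inf m x = Max ((\<lambda>j. \<bar>x j\<bar>) ` {..<m})"

text \<open>Only meaningful for invertible matrices.\<close>

definition minv :: "real mat \<Rightarrow> real mat" where
  "minv A = the (mat_inverse A)"

text \<open>
  The nondegenerate normal distribution \<open>N_m(0, S)\<close>, given by its Lebesgue density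
  \<open>((2 \<pi>)^m det S)^(-1/2) exp (- x^T S^(-1) x / 2)\<close>. It is used only for symmetric positive
  definite \<open>S\<close>.
\<close>

definition mvn :: "nat \<Rightarrow> real mat \<Rightarrow> (nat \<Rightarrow> real) measure" where
  "mvn m S = density (\<Pi>\<^sub>M i\<in>{..<m}. lborel)
     (\<lambda>x. ennreal (exp (- (\<Sum>i<m. \<Sum>j<m. x i * (minv S $$ (i, j)) * x j) / 2)
                    / sqrt ((2 * pi) ^ m * Determinant.det S)))"

text \<open>A parameter is a triple \<open>(\<beta>, \<Omega>, \<sigma>)\<close>, where \<open>\<Omega>\<close> is the inverse covariance matrix.\<close>

type_synonym param = "(nat \<Rightarrow> real) \<times> real mat \<times> real"

text \<open>An observation maps \<open>i < n\<close> to the pair \<open>Z_i = (y_i, X_i)\<close>.\<close>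

type_synonym obs = "nat \<Rightarrow> real \<times> (nat \<Rightarrow> real)"

definition obs_space :: "nat \<Rightarrow> nat \<Rightarrow> obs measure" where
  "obs_space n p = (\<Pi>\<^sub>M i\<in>{..<n}. borel \<Otimes>\<^sub>M (\<Pi>\<^sub>M j\<in>{..<p}. borel))"

text \<open>
  The law of \<open>Z\<close> under \<open>y = X \<beta> + \<epsilon>\<close>: the rows of \<open>X\<close> are independent with law
  \<open>N_p(0, \<Omega>^(-1))\<close>, and \<open>\<epsilon>\<close> has law \<open>N_n(0, \<sigma>^2 I)\<close> and is independent of \<open>X\<close>.
\<close>

definition law :: "nat \<Rightarrow> nat \<Rightarrow> param \<Rightarrow> obs measure" where
  "law n p = (\<lambda>(\<beta>, \<Omega>, \<sigma>).
     distr ((\<Pi>\<^sub>M i\<in>{..<n}. mvn p (minv \<Omega>)) \<Otimes>\<^sub>M mvn n (\<sigma>\<^sup>2 \<cdot>\<^sub>m 1\<^sub>m n)) (obs_space n p)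
       (\<lambda>(X, \<epsilon>). \<lambda>i\<in>{..<n}. (dotp p (X i) \<beta> + \<epsilon> i, X i)))"

text \<open>For a symmetric real matrix of positive dimension the spectrum is finite and nonempty.\<close>

definition lambda_min :: "real mat \<Rightarrow> real" where
  "lambda_min A = Min (spectrum A)"

definition lambda_max :: "real mat \<Rightarrow> real" where
  "lambda_max A = Max (spectrum A)"

definition Theta :: "nat \<Rightarrow> real \<Rightarrow> real \<Rightarrow> nat \<Rightarrow> param set" where
  "Theta p M1 M2 k = {(\<beta>, \<Omega>, \<sigma>).
     \<beta> \<in> Rn p \<and> norm0 p \<beta> \<le> k \<and>
     \<Omega> \<in> carrier_mat p p \<and> transpose_mat \<Omega> = \<Omega> \<and>
     1 / M1 \<le> lambda_min \<Omega> \<and> lambda_min \<Omega> \<le> lambda_max \<Omega> \<and> lambda_max \<Omega> \<le> M1 \<and>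
     0 < \<sigma> \<and> \<sigma> \<le> M2}"

definition Xi :: "nat \<Rightarrow> nat \<Rightarrow> real \<Rightarrow> (nat \<Rightarrow> real) set" where
  "Xi p q cbar = {\<xi> \<in> Rn p. norm0 p \<xi> = q \<and> \<xi> \<noteq> (\<lambda>j\<in>{..<p}. 0) \<and>
     Max ((\<lambda>j. \<bar>\<xi> j\<bar>) ` supp p \<xi>) / Min ((\<lambda>j. \<bar>\<xi> j\<bar>) ` supp p \<xi>) \<le> cbar}"

text \<open>
  Measurable intervals with coverage at least \<open>1 - \<alpha>\<close> uniformly over \<open>\<Theta>\<close>. The condition
  \<open>l \<le> u\<close> matters: otherwise an interval could be empty and have negative length.
\<close>

definition conf_intervals ::
  "nat \<Rightarrow> nat \<Rightarrow> real \<Rightarrow> param set \<Rightarrow> ((nat \<Rightarrow> real) \<Rightarrow> real) \<Rightarrow> ((obs \<Rightarrow> real) \<times> (obs \<Rightarrow> real)) set"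
  where
  "conf_intervals n p \<alpha> \<Theta> T = {(l, u).
     l \<in> borel_measurable (obs_space n p) \<and> u \<in> borel_measurable (obs_space n p) \<and>
     (\<forall>z\<in>space (obs_space n p). l z \<le> u z) \<and>
     (\<forall>\<theta>\<in>\<Theta>. measure (law n p \<theta>)
        {z \<in> space (obs_space n p). l z \<le> T (fst \<theta>) \<and> T (fst \<theta>) \<le> u z} \<ge> 1 - \<alpha>)}"

text \<open>Expected lengths may be infinite, hence values in \<open>ennreal\<close>.\<close>

definition L_star ::
  "nat \<Rightarrow> nat \<Rightarrow> real \<Rightarrow> param set \<Rightarrow> param set \<Rightarrow> ((nat \<Rightarrow> real) \<Rightarrow> real) \<Rightarrow> ennreal" where
  "L_star n p \<alpha> \<Theta>1 \<Theta> T =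
     (INF (l, u) \<in> conf_intervals n p \<alpha> \<Theta> T. SUP \<theta>\<in>\<Theta>1. \<integral>\<^sup>+z. ennreal (u z - l z) \<partial>law n p \<theta>)"

text \<open>
  The dense loading regime \<open>q = c_q p^\<gamma>\<^sub>q\<close>. As \<open>q\<close> is an integer, the equation is read up to
  rounding, which covers exact equality as well as rounding up and rounding down.
\<close>

definition dense_loading ::
  "nat \<Rightarrow> real \<Rightarrow> real \<Rightarrow> real \<Rightarrow> (nat \<Rightarrow> real) \<Rightarrow> bool" where
  "dense_loading p cbar cq \<gamma>q \<xi> \<longleftrightarrow>
     (\<exists>q. \<bar>real q - cq * real p powr \<gamma>q\<bar> < 1 \<and> \<xi> \<in> Xi p q cbar)"

end

theory Submission
  imports Defs
begin

text \<open>
  An interval that covers \<open>\<xi>\<^sup>T \<beta>\<close> uniformly over \<open>\<Theta>(k)\<close> must be long already at \<open>\<beta> = 0\<close> if the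
  null law cannot be told apart from a mixture of laws under which \<open>\<xi>\<^sup>T \<beta>\<close> is large: under the null
  law it contains \<open>0\<close>, and it must also reach the large value, since its upper end does so under the
  mixture. Indistinguishability is measured by the second moment of the likelihood ratio
  (\<open>mixture_second_moment_bound\<close>, \<open>expected_length_lower_bound\<close>).

  The alternatives are chosen through the reverse regression: \<open>y \<sim> N(0, \<sigma>\<^sup>2)\<close> as under the null law,
  and \<open>X\<^sub>i\<close> given \<open>y\<^sub>i\<close> is \<open>N(y\<^sub>i u, I)\<close> instead of \<open>N(0, I)\<close>. Rewritten as a regression of \<open>y\<close> on
  \<open>X\<close>, this is the parameter \<open>spiked_param p \<sigma> u\<close>, whose \<open>\<Omega>\<close> is a rank-one perturbation of the
  identity and whose \<open>\<beta>\<close> is proportional to \<open>u\<close>. It uses that \<open>\<Omega>\<close> and \<open>\<sigma>\<close> are unknown: both move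
  with \<open>u\<close> such that the marginal law of \<open>y\<close> is unchanged. Given \<open>y\<close>, the
  log-likelihood ratio is affine in \<open>X\<close>, so that the product of two of them
  has expectation \<open>(1 - 2 \<sigma>\<^sup>2 \<langle>u, v\<rangle>)\<^sup>-\<^sup>1\<^sup>/\<^sup>2\<close> per observation (\<open>nn_integral_row_lr_product\<close>); only the
  overlap of the two spikes counts.

  The vector \<open>u\<close> carries \<open>m\<close> entries \<open>\<plusminus> t\<close> with \<open>m = min k q\<close>, \<open>\<sigma>\<^sup>2 t\<^sup>2 = a log p / n\<close> and signs
  matching those of \<open>\<xi>\<close>, so that \<open>\<xi>\<^sup>T \<beta>\<close> is of order \<open>\<parallel>\<xi>\<parallel>\<^sub>\<infinity> k (log p / n)\<^sup>1\<^sup>/\<^sup>2\<close>. Its support is drawn by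
  cutting the support of \<open>\<xi>\<close>, of size \<open>q\<close>, into \<open>m\<close> blocks of length \<open>b\<close> and picking one index per
  block. Two such supports agree in each block independently with probability \<open>1 / b\<close>, so the second
  moment is at most \<open>(1 + (p\<^sup>2\<^sup>a - 1) / b)\<^sup>m \<le> exp (m (p\<^sup>2\<^sup>a - 1) / b)\<close>. As \<open>m / b \<le> 2 k\<^sup>2 / q\<close> is of order
  \<open>p\<close> to the power \<open>2 \<gamma> - \<gamma>\<^sub>q < 0\<close>, a small constant \<open>a\<close> makes it close to \<open>1\<close> for all \<open>p\<close> at once.
\<close>


section \<open>Rank-one perturbations of the identity matrix\<close>

definition rank1_update :: "nat \<Rightarrow> real \<Rightarrow> (nat \<Rightarrow> real) \<Rightarrow> real mat" where
  "rank1_update p c s = mat p p (\<lambda>(i, j). (if i = j then 1 else 0) + c * s i * s j)"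

lemma rank1_update_carrier [simp]: "rank1_update p c s \<in> carrier_mat p p"
  by (simp add: rank1_update_def)

lemma dim_rank1_update [simp]:
  "dim_row (rank1_update p c s) = p" "dim_col (rank1_update p c s) = p"
  by (simp_all add: rank1_update_def)

lemma rank1_update_index [simp]:
  "i < p \<Longrightarrow> j < p \<Longrightarrow> rank1_update p c s $$ (i, j) = (if i = j then 1 else 0) + c * s i * s j"
  by (simp add: rank1_update_def)

lemma rank1_update_0 [simp]: "rank1_update p 0 s = 1\<^sub>m p"
  by (rule eq_matI) auto

text \<open>
  The updates along a fixed vector are closed under multiplication, because \<open>(s s\<^sup>T) (s s\<^sup>T)\<close> is a
  multiple of \<open>s s\<^sup>T\<close>. Inverses are therefore found by solving a scalar equation.
\<close>

lemma rank1_update_mult: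
  "rank1_update p c s * rank1_update p d s = rank1_update p (c + d + c * d * dotp p s s) s"
proof (rule eq_matI)
  fix i j assume "i < dim_row (rank1_update p (c + d + c * d * dotp p s s) s)"
    and "j < dim_col (rank1_update p (c + d + c * d * dotp p s s) s)"
  then have ij: "i < p" "j < p" by auto
  have "(rank1_update p c s * rank1_update p d s) $$ (i, j)
      = (\<Sum>k\<in>{0..<p}. ((if i = k then 1 else 0) + c * s i * s k) * ((if k = j then 1 else 0) + d * s k * s j))"
    using ij by (simp add: times_mat_def scalar_prod_def)
  also have "\<dots> = (\<Sum>k\<in>{0..<p}. (if i = k then (if k = j then 1 else 0) else 0)
       + (if i = k then d * s k * s j else 0) + (if k = j then c * s i * s k else 0) + c * d * s i * s j * (s k * s k))"
    by (rule sum.cong) (auto simp: algebra_simps)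
  also have "\<dots> = (if i = j then 1 else 0) + d * s i * s j + c * s i * s j + c * d * s i * s j * dotp p s s"
    using ij by (simp add: sum.distrib sum_distrib_left[symmetric] dotp_def atLeast0LessThan)
  finally show "(rank1_update p c s * rank1_update p d s) $$ (i, j)
      = rank1_update p (c + d + c * d * dotp p s s) s $$ (i, j)"
    using ij by (simp add: algebra_simps)
qed auto

lemma minv_eqI:
  assumes A: "A \<in> carrier_mat n n" and B: "B \<in> carrier_mat n n" and AB: "A * B = 1\<^sub>m n"
  shows "minv A = B"
proof -
  have BA: "B * A = 1\<^sub>m n" by (rule mat_mult_left_right_inverse[OF A B AB])
  have "A \<in> Units (ring_mat TYPE(real) n undefined)"
    unfolding Units_def using A B AB BA by (auto simp: ring_mat_def)
  then obtain C where C: "mat_inverse A = Some C"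
    using mat_inverse(1)[OF A, where b = undefined] by (cases "mat_inverse A") auto
  from mat_inverse(2)[OF A C] have "A * C = 1\<^sub>m n" "C \<in> carrier_mat n n" by auto
  then have "C = (B * A) * C" using BA by simp
  also have "\<dots> = B * (A * C)" using A B \<open>C \<in> _\<close> by (simp add: assoc_mult_mat)
  also have "\<dots> = B" using \<open>A * C = _\<close> B by simp
  finally show ?thesis using C by (simp add: minv_def)
qed

lemma minv_rank1_update:
  assumes "c + d + c * d * dotp p s s = 0"
  shows "minv (rank1_update p c s) = rank1_update p d s"
  by (rule minv_eqI[of _ p]) (simp_all add: rank1_update_mult assms)

text \<open>
  The matrix determinant lemma. With \<open>U\<close> the column \<open>s\<close>, \<open>V\<close> the row \<open>c s\<^sup>T\<close> and \<open>W\<close> the scalar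
  \<open>1 + V U\<close>, the block matrix \<open>[I, 0; V, 1]\<close> conjugates \<open>[R, U; 0, 1]\<close>, where \<open>R = I + U V\<close>, into
  \<open>[I, U; 0, W]\<close>; both of these are block triangular.
\<close>

lemma det_rank1_update: "Determinant.det (rank1_update p c s) = 1 + c * dotp p s s"
proof -
  note One_nat_def [simp del]
  define U where "U = mat p 1 (\<lambda>(i, j). s i)"
  define V where "V = mat 1 p (\<lambda>(i, j). c * s j)"
  define R where "R = rank1_update p c s"
  define W where "W = mat 1 1 (\<lambda>(i, j). 1 + c * dotp p s s)"
  have car0 [simp]: "U \<in> carrier_mat p 1" "V \<in> carrier_mat 1 p" "R \<in> carrier_mat p p"
     "W \<in> carrier_mat 1 1"
    by (auto simp: U_def V_def R_def W_def)
  define A where "A = four_block_mat (1\<^sub>m p) (0\<^sub>m p 1) V (1\<^sub>m 1)"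
  define B where "B = four_block_mat R U (0\<^sub>m 1 p) (1\<^sub>m 1)"
  define D where "D = four_block_mat (1\<^sub>m p) U (0\<^sub>m 1 p) W"
  have [simp]: "U * V \<in> carrier_mat p p" by (rule mult_carrier_mat[of _ p 1]) simp_all
  have UV: "1\<^sub>m p + U * V = R"
    by (rule eq_matI) (auto simp: U_def V_def R_def times_mat_def scalar_prod_def)
  have VU: "V * U + 1\<^sub>m 1 = W"
    by (rule eq_matI) (auto simp: U_def V_def W_def times_mat_def scalar_prod_def dotp_def
        sum_distrib_left atLeast0LessThan mult.assoc)
  have VR: "V * R = W * V"
  proof -
    have "V * R = V * 1\<^sub>m p + V * (U * V)"
      unfolding UV[symmetric] by (rule mult_add_distrib_mat[of _ 1 p _ p]) auto
    also have "V * (U * V) = V * U * V" by (rule assoc_mult_mat[symmetric, of _ 1 p _ 1 _ p]) auto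
    also have "V * 1\<^sub>m p + V * U * V = W * V"
    proof -
      have 1: "V * U \<in> carrier_mat 1 1" by (rule mult_carrier_mat[of _ 1 p]) simp_all
      have 2: "V * U * V \<in> carrier_mat 1 p" by (rule mult_carrier_mat[OF 1]) simp
      have "W * V = V * U * V + 1\<^sub>m 1 * V"
        unfolding VU[symmetric] by (rule add_mult_distrib_mat[OF 1, of _ _ p]) simp_all
      also have "1\<^sub>m 1 * V = V * 1\<^sub>m p"
        using left_mult_one_mat[of V 1 p] right_mult_one_mat[of V 1 p] by simp
      also have "V * U * V + V * 1\<^sub>m p = V * 1\<^sub>m p + V * U * V"
        by (rule comm_add_mat[OF 2]) (rule mult_carrier_mat[of _ 1 p _ p], simp_all)
      finally show ?thesis by simp
    qed
    finally show ?thesis .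
  qed
  have VR_car: "V * R \<in> carrier_mat 1 p" by (rule mult_carrier_mat[of _ 1 p _ p]) simp_all
  have WV_car: "W * V \<in> carrier_mat 1 p" by (rule mult_carrier_mat[of _ 1 1 _ p]) simp_all
  have AB: "A * B = four_block_mat R U (V * R) W"
  proof -
    have "A * B = four_block_mat (1\<^sub>m p * R + 0\<^sub>m p 1 * 0\<^sub>m 1 p) (1\<^sub>m p * U + 0\<^sub>m p 1 * 1\<^sub>m 1)
        (V * R + 1\<^sub>m 1 * 0\<^sub>m 1 p) (V * U + 1\<^sub>m 1 * 1\<^sub>m 1)"
      unfolding A_def B_def by (rule mult_four_block_mat) (fact zero_carrier_mat one_carrier_mat car0)+
    also have "1\<^sub>m p * R + 0\<^sub>m p 1 * 0\<^sub>m 1 p = R"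
      by (simp only: left_mult_one_mat[OF car0(3)] left_mult_zero_mat[OF zero_carrier_mat]
          right_add_zero_mat[OF car0(3)])
    also have "1\<^sub>m p * U + 0\<^sub>m p 1 * 1\<^sub>m 1 = U"
      by (simp only: left_mult_one_mat[OF car0(1)] left_mult_zero_mat[OF one_carrier_mat]
          right_add_zero_mat[OF car0(1)])
    also have "V * R + 1\<^sub>m 1 * 0\<^sub>m 1 p = V * R"
      by (simp only: right_mult_zero_mat[OF one_carrier_mat] right_add_zero_mat[OF VR_car])
    also have "V * U + 1\<^sub>m 1 * 1\<^sub>m 1 = W"
      by (simp only: VU left_mult_one_mat[OF one_carrier_mat])
    finally show ?thesis .
  qed
  have DA: "D * A = four_block_mat R U (W * V) W"
  proof -
    have "D * A = four_block_mat (1\<^sub>m p * 1\<^sub>m p + U * V) (1\<^sub>m p * 0\<^sub>m p 1 + U * 1\<^sub>m 1)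
        (0\<^sub>m 1 p * 1\<^sub>m p + W * V) (0\<^sub>m 1 p * 0\<^sub>m p 1 + W * 1\<^sub>m 1)"
      unfolding A_def D_def by (rule mult_four_block_mat) (fact zero_carrier_mat one_carrier_mat car0)+
    also have "1\<^sub>m p * 1\<^sub>m p + U * V = R"
      by (simp only: UV left_mult_one_mat[OF one_carrier_mat])
    also have "1\<^sub>m p * 0\<^sub>m p 1 + U * 1\<^sub>m 1 = U"
      by (simp only: right_mult_zero_mat[OF one_carrier_mat] right_mult_one_mat[OF car0(1)]
          left_add_zero_mat[OF car0(1)])
    also have "0\<^sub>m 1 p * 1\<^sub>m p + W * V = W * V"
      by (simp only: left_mult_zero_mat[OF one_carrier_mat] left_add_zero_mat[OF WV_car])
    also have "0\<^sub>m 1 p * 0\<^sub>m p 1 + W * 1\<^sub>m 1 = W"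
      by (simp only: left_mult_zero_mat[OF zero_carrier_mat] right_mult_one_mat[OF car0(4)]
          left_add_zero_mat[OF car0(4)])
    finally show ?thesis .
  qed
  have car: "A \<in> carrier_mat (p + 1) (p + 1)" "B \<in> carrier_mat (p + 1) (p + 1)"
     "D \<in> carrier_mat (p + 1) (p + 1)"
    unfolding A_def B_def D_def
    by (intro four_block_carrier_mat one_carrier_mat car0)+
  have "Determinant.det A * Determinant.det B = Determinant.det D * Determinant.det A"
    unfolding det_mult[OF car(1,2), symmetric] det_mult[OF car(3,1), symmetric] AB DA VR ..
  moreover have "Determinant.det A = Determinant.det (1\<^sub>m p) * Determinant.det (1\<^sub>m 1)"
    unfolding A_def by (rule det_four_block_mat_upper_right_zero[OF one_carrier_mat refl car0(2) one_carrier_mat])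
  moreover have "Determinant.det B = Determinant.det R * Determinant.det (1\<^sub>m 1)"
    unfolding B_def by (rule det_four_block_mat_lower_left_zero[OF car0(3,1) refl one_carrier_mat])
  moreover have "Determinant.det D = Determinant.det (1\<^sub>m p) * Determinant.det W"
    unfolding D_def by (rule det_four_block_mat_lower_left_zero[OF one_carrier_mat car0(1) refl car0(4)])
  moreover have "Determinant.det W = 1 + c * dotp p s s"
    using det_single[OF car0(4)] by (simp add: W_def)
  ultimately show ?thesis by (simp add: R_def)
qed

text \<open>
  The vector \<open>s\<close> is an eigenvector for \<open>1 + c |s|\<^sup>2\<close>. An eigenvector orthogonal to \<open>s\<close> is
  fixed; for any other one, pairing the eigenvalue equation with \<open>s\<close> gives the same eigenvalue as
  that of \<open>s\<close>. Membership is stated besides the inclusion because minimum and maximum of the spectrum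
  are meaningful only if it is nonempty.
\<close>

lemma spectrum_rank1_update:
  assumes "l < p" "s l \<noteq> 0"
  shows "1 + c * dotp p s s \<in> spectrum (rank1_update p c s)"
    and "spectrum (rank1_update p c s) \<subseteq> {1, 1 + c * dotp p s s}"
proof -
  have mv: "vec_index (rank1_update p c s *\<^sub>v v) i = vec_index v i + c * s i * (\<Sum>j<p. s j * vec_index v j)"
    if "dim_vec v = p" "i < p" for v i
  proof -
    have "vec_index (rank1_update p c s *\<^sub>v v) i
        = (\<Sum>j\<in>{0..<p}. ((if i = j then 1 else 0) + c * s i * s j) * vec_index v j)"
      using that by (simp add: mult_mat_vec_def scalar_prod_def)
    also have "\<dots> = (\<Sum>j\<in>{0..<p}. (if i = j then vec_index v j else 0) + c * s i * (s j * vec_index v j))"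
      by (rule sum.cong) (auto simp: algebra_simps)
    also have "\<dots> = vec_index v i + c * s i * (\<Sum>j<p. s j * vec_index v j)"
      using that by (subst sum.distrib) (simp add: sum_distrib_left[symmetric] atLeast0LessThan)
    finally show ?thesis .
  qed
  have "eigenvector (rank1_update p c s) (vec p s) (1 + c * dotp p s s)"
    unfolding eigenvector_def
  proof (intro conjI)
    show "vec p s \<noteq> 0\<^sub>v (dim_row (rank1_update p c s))"
    proof
      assume "vec p s = 0\<^sub>v (dim_row (rank1_update p c s))"
      then have "vec_index (vec p s) l = vec_index (0\<^sub>v p) l" by simp
      with assms show False by simp
    qed
    show "rank1_update p c s *\<^sub>v vec p s = (1 + c * dotp p s s) \<cdot>\<^sub>v vec p s"
    proof (rule eq_vecI)
      fix i assume "i < dim_vec ((1 + c * dotp p s s) \<cdot>\<^sub>v vec p s)"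
      then have i: "i < p" by simp
      have "vec_index (rank1_update p c s *\<^sub>v vec p s) i = s i + c * s i * (\<Sum>j<p. s j * vec_index (vec p s) j)"
        using i by (subst mv) simp_all
      also have "(\<Sum>j<p. s j * vec_index (vec p s) j) = dotp p s s"
        unfolding dotp_def by (rule sum.cong) simp_all
      finally show "vec_index (rank1_update p c s *\<^sub>v vec p s) i = vec_index ((1 + c * dotp p s s) \<cdot>\<^sub>v vec p s) i"
        using i by (simp add: distrib_right)
    qed simp
  qed auto
  then show "1 + c * dotp p s s \<in> spectrum (rank1_update p c s)"
    unfolding spectrum_def eigenvalue_def mem_Collect_eq by (rule exI)
  show "spectrum (rank1_update p c s) \<subseteq> {1, 1 + c * dotp p s s}"
  proof
    fix k assume "k \<in> spectrum (rank1_update p c s)"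
    then obtain v where v': "eigenvector (rank1_update p c s) v k"
      unfolding spectrum_def eigenvalue_def mem_Collect_eq by (rule exE)
    then have v'': "v \<in> carrier_vec p \<and> v \<noteq> 0\<^sub>v p \<and> rank1_update p c s *\<^sub>v v = k \<cdot>\<^sub>v v"
      unfolding eigenvector_def dim_rank1_update .
    note v = carrier_vecD[OF conjunct1[OF v'']] conjunct1[OF conjunct2[OF v'']] conjunct2[OF conjunct2[OF v'']]
    define d where "d = (\<Sum>j<p. s j * vec_index v j)"
    have e: "k * vec_index v i = vec_index v i + c * s i * d" if "i < p" for i
      using mv[OF v(1) that] v(1) that unfolding v(3) d_def by simp
    show "k \<in> {1, 1 + c * dotp p s s}"
    proof (cases "d = 0")
      case True
      obtain i where "i < p" "vec_index v i \<noteq> 0"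
        using v(1,2) by (metis eq_vecI index_zero_vec(1) index_zero_vec(2))
      then show ?thesis using e[of i] True by simp
    next
      case False
      have "k * d = (\<Sum>j<p. s j * (k * vec_index v j))" by (simp add: d_def sum_distrib_left algebra_simps)
      also have "\<dots> = (\<Sum>j<p. s j * vec_index v j + c * d * (s j * s j))"
        by (rule sum.cong) (auto simp: e algebra_simps)
      also have "\<dots> = d * (1 + c * dotp p s s)"
        by (simp add: sum.distrib sum_distrib_left[symmetric] d_def[symmetric] dotp_def algebra_simps)
      finally show ?thesis using False by simp
    qed
  qed
qed

lemma quadratic_form_rank1_update:
  "(\<Sum>i<p. \<Sum>j<p. x i * (rank1_update p c s $$ (i, j)) * x j) = dotp p x x + c * (dotp p s x)\<^sup>2"
proof -
  have "(\<Sum>i<p. \<Sum>j<p. x i * (rank1_update p c s $$ (i, j)) * x j)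
      = (\<Sum>i<p. \<Sum>j<p. (if i = j then x i * x j else 0) + c * ((s i * x i) * (s j * x j)))"
    by (intro sum.cong refl) (auto simp: algebra_simps)
  also have "\<dots> = dotp p x x + c * (\<Sum>i<p. \<Sum>j<p. (s i * x i) * (s j * x j))"
    by (simp add: sum.distrib dotp_def sum_distrib_left)
  also have "\<dots> = dotp p x x + c * (dotp p s x)\<^sup>2"
    by (simp add: dotp_def sum_product power2_eq_square)
  finally show ?thesis .
qed

section \<open>Gaussian product measures\<close>

definition gauss :: "real \<Rightarrow> real measure" where
  "gauss \<sigma> = density lborel (\<lambda>x. ennreal (normal_density 0 \<sigma> x))"

lemma sets_gauss [simp, measurable_cong]: "sets (gauss \<sigma>) = sets borel"
  by (simp add: gauss_def)

lemma prob_space_gauss: "0 < \<sigma> \<Longrightarrow> prob_space (gauss \<sigma>)"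
  unfolding gauss_def by (rule prob_space_normal_density)

text \<open>
  Both sides agree on boxes, where the integral of a product of functions of separate coordinates
  factorizes.
\<close>

lemma PiM_density_same:
  fixes I :: "'i set" and M :: "'a measure"
  assumes I: "finite I" and M: "sigma_finite_measure M" and f [measurable]: "f \<in> borel_measurable M"
    and D: "sigma_finite_measure (density M f)"
  shows "density (\<Pi>\<^sub>M i\<in>I. M) (\<lambda>x. \<Prod>i\<in>I. f (x i)) = (\<Pi>\<^sub>M i\<in>I. density M f)"
proof -
  interpret D: product_sigma_finite "\<lambda>_::'i. density M f"
    by (simp add: product_sigma_finite_def D)
  interpret M: product_sigma_finite "\<lambda>_::'i. M"
    by (simp add: product_sigma_finite_def M)
  show ?thesis
  proof (rule D.PiM_eqI)
    show "sets (density (\<Pi>\<^sub>M i\<in>I. M) (\<lambda>x. \<Prod>i\<in>I. f (x i))) = sets (\<Pi>\<^sub>M i\<in>I. density M f)"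
      unfolding sets_density by (rule sets_PiM_cong) auto
    fix A assume "\<And>i. i \<in> I \<Longrightarrow> A i \<in> sets (density M f)"
    then have A [measurable]: "i \<in> I \<Longrightarrow> A i \<in> sets M" for i by auto
    have "emeasure (density (\<Pi>\<^sub>M i\<in>I. M) (\<lambda>x. \<Prod>i\<in>I. f (x i))) (Pi\<^sub>E I A)
        = (\<integral>\<^sup>+x. (\<Prod>i\<in>I. f (x i)) * indicator (Pi\<^sub>E I A) x \<partial>(\<Pi>\<^sub>M i\<in>I. M))"
      using A I by (subst emeasure_density) (auto intro!: sets_PiM_I_finite)
    also have "\<dots> = (\<integral>\<^sup>+x. (\<Prod>i\<in>I. f (x i) * indicator (A i) (x i)) \<partial>(\<Pi>\<^sub>M i\<in>I. M))"
    proof (rule nn_integral_cong)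
      fix x assume "x \<in> space (\<Pi>\<^sub>M i\<in>I. M)"
      then have "indicator (Pi\<^sub>E I A) x = (\<Prod>i\<in>I. indicator (A i) (x i) :: ennreal)"
        using I by (auto simp: indicator_def space_PiM PiE_iff prod_zero_iff)
      then show "(\<Prod>i\<in>I. f (x i)) * indicator (Pi\<^sub>E I A) x = (\<Prod>i\<in>I. f (x i) * indicator (A i) (x i))"
        by (simp add: prod.distrib)
    qed
    also have "\<dots> = (\<Prod>i\<in>I. \<integral>\<^sup>+x. f x * indicator (A i) x \<partial>M)"
      by (rule M.product_nn_integral_prod) (use I in auto)
    also have "\<dots> = (\<Prod>i\<in>I. emeasure (density M f) (A i))"
      by (rule prod.cong) (auto simp: emeasure_density)
    finally show "emeasure (density (\<Pi>\<^sub>M i\<in>I. M) (\<lambda>x. \<Prod>i\<in>I. f (x i))) (Pi\<^sub>E I A)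
        = (\<Prod>i\<in>I. emeasure (density M f) (A i))" .
  qed fact
qed

lemma sigma_finite_density_real:
  assumes "prob_space M" "f \<in> borel_measurable M"
  shows "sigma_finite_measure (density M (\<lambda>x. ennreal (f x)))"
proof -
  interpret prob_space M by fact
  show ?thesis using assms(2)
    by (subst sigma_finite_iff_density_finite) auto
qed

lemma PiM_gauss:
  assumes "0 < \<sigma>"
  shows "(\<Pi>\<^sub>M i\<in>{..<m}. gauss \<sigma>) = density (\<Pi>\<^sub>M i\<in>{..<m}. lborel)
     (\<lambda>x. ennreal (exp (- dotp m x x / (2 * \<sigma>\<^sup>2)) / sqrt ((2 * pi * \<sigma>\<^sup>2) ^ m)))"
proof -
  interpret prob_space "gauss \<sigma>" by (rule prob_space_gauss[OF assms])
  have "(\<Pi>\<^sub>M i\<in>{..<m}. gauss \<sigma>)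
      = density (\<Pi>\<^sub>M i\<in>{..<m}. lborel) (\<lambda>x. \<Prod>i<m. ennreal (normal_density 0 \<sigma> (x i)))"
    unfolding gauss_def
    by (rule PiM_density_same[symmetric])
       (auto simp: gauss_def[symmetric] sigma_finite_measure_axioms lborel.sigma_finite_measure_axioms)
  also have "\<dots> = density (\<Pi>\<^sub>M i\<in>{..<m}. lborel)
     (\<lambda>x. ennreal (exp (- dotp m x x / (2 * \<sigma>\<^sup>2)) / sqrt ((2 * pi * \<sigma>\<^sup>2) ^ m)))"
  proof (rule arg_cong[where f = "density _"], rule ext)
    fix x :: "nat \<Rightarrow> real"
    have "(\<Prod>i<m. normal_density 0 \<sigma> (x i)) = (\<Prod>i<m. 1 / sqrt (2 * pi * \<sigma>\<^sup>2)) * exp (\<Sum>i<m. - (x i)\<^sup>2 / (2 * \<sigma>\<^sup>2))"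
      unfolding normal_density_def prod.distrib by (simp add: exp_sum)
    also have "\<dots> = exp (- dotp m x x / (2 * \<sigma>\<^sup>2)) / sqrt ((2 * pi * \<sigma>\<^sup>2) ^ m)"
      by (simp add: dotp_def real_sqrt_power power_divide sum_divide_distrib sum_negf power2_eq_square)
    finally show "(\<Prod>i<m. ennreal (normal_density 0 \<sigma> (x i)))
       = ennreal (exp (- dotp m x x / (2 * \<sigma>\<^sup>2)) / sqrt ((2 * pi * \<sigma>\<^sup>2) ^ m))"
      by (simp add: prod_ennreal)
  qed
  finally show ?thesis .
qed

lemma measurable_dotp [measurable]:
  "(\<lambda>x. dotp p u x) \<in> borel_measurable (\<Pi>\<^sub>M j\<in>{..<p}. borel)"
  unfolding dotp_def by measurable

lemma measurable_dotp_self [measurable]: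
  "(\<lambda>x. dotp p x x) \<in> borel_measurable (\<Pi>\<^sub>M j\<in>{..<p}. borel)"
  unfolding dotp_def by measurable

lemma measurable_dotp2 [measurable]:
  "(\<lambda>x. dotp p x u) \<in> borel_measurable (\<Pi>\<^sub>M j\<in>{..<p}. borel)"
  unfolding dotp_def by measurable

lemma dotp_nonneg: "0 \<le> dotp p u u"
  by (simp add: dotp_def sum_nonneg)

lemma sets_PiM_lborel_real: "sets (\<Pi>\<^sub>M j\<in>I. lborel) = sets (\<Pi>\<^sub>M j\<in>I. (borel :: real measure))"
  by (rule sets_PiM_cong) auto

lemma sets_PiM_gauss [measurable_cong, simp]:
  "sets (\<Pi>\<^sub>M j\<in>I. gauss \<sigma>) = sets (\<Pi>\<^sub>M j\<in>I. borel)"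
  by (rule sets_PiM_cong) auto

lemma prob_space_PiM_gauss: "0 < \<sigma> \<Longrightarrow> prob_space (\<Pi>\<^sub>M j\<in>I. gauss \<sigma>)"
  by (rule prob_space_PiM) (rule prob_space_gauss)

lemma sets_mvn [measurable_cong, simp]: "sets (mvn p S) = sets (\<Pi>\<^sub>M j\<in>{..<p}. borel)"
  unfolding mvn_def by (simp add: sets_PiM_lborel_real)

text \<open>
  The centred normal law with covariance \<open>I + d s s\<^sup>T\<close> relative to the standard one: \<open>c\<close> is the
  coefficient of the inverse \<open>I + c s s\<^sup>T\<close>, and the quadratic forms differ by \<open>c (s\<^sup>T x)\<^sup>2\<close>.
\<close>

lemma mvn_rank1_update:
  assumes cd: "c + d + c * d * dotp p s s = 0" and pos: "0 < 1 + d * dotp p s s"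
  shows "mvn p (rank1_update p d s) = density (\<Pi>\<^sub>M j\<in>{..<p}. gauss 1)
     (\<lambda>x. ennreal (exp (- c * (dotp p s x)\<^sup>2 / 2) / sqrt (1 + d * dotp p s s)))"
proof -
  have inv: "minv (rank1_update p d s) = rank1_update p c s"
    by (rule minv_rank1_update) (use cd in \<open>simp add: algebra_simps\<close>)
  have [measurable]: "(\<lambda>x. dotp p s x) \<in> borel_measurable (\<Pi>\<^sub>M j\<in>{..<p}. lborel)"
    "(\<lambda>x. dotp p x x) \<in> borel_measurable (\<Pi>\<^sub>M j\<in>{..<p}. lborel)"
    using measurable_dotp[of p s] measurable_dotp_self[of p]
    by (simp_all cong: measurable_cong_sets add: sets_PiM_lborel_real)
  have gauss1: "(\<Pi>\<^sub>M j\<in>{..<p}. gauss 1) = density (\<Pi>\<^sub>M i\<in>{..<p}. lborel)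
     (\<lambda>x. ennreal (exp (- dotp p x x / (2 * 1\<^sup>2)) / sqrt ((2 * pi * 1\<^sup>2) ^ p)))"
    by (rule PiM_gauss) simp
  show ?thesis
    unfolding mvn_def inv gauss1 quadratic_form_rank1_update det_rank1_update
  proof (subst density_density_eq)
    show "density (\<Pi>\<^sub>M i\<in>{..<p}. lborel)
       (\<lambda>x. ennreal (exp (- (dotp p x x + c * (dotp p s x)\<^sup>2) / 2) / sqrt ((2 * pi) ^ p * (1 + d * dotp p s s))))
     = density (\<Pi>\<^sub>M i\<in>{..<p}. lborel)
       (\<lambda>x. ennreal (exp (- dotp p x x / (2 * 1\<^sup>2)) / sqrt ((2 * pi * 1\<^sup>2) ^ p)) *
            ennreal (exp (- c * (dotp p s x)\<^sup>2 / 2) / sqrt (1 + d * dotp p s s)))"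
    proof (rule arg_cong[where f = "density _"], rule ext)
      fix x
      show "ennreal (exp (- (dotp p x x + c * (dotp p s x)\<^sup>2) / 2) / sqrt ((2 * pi) ^ p * (1 + d * dotp p s s)))
        = ennreal (exp (- dotp p x x / (2 * 1\<^sup>2)) / sqrt ((2 * pi * 1\<^sup>2) ^ p)) *
            ennreal (exp (- c * (dotp p s x)\<^sup>2 / 2) / sqrt (1 + d * dotp p s s))"
        using pos by (subst ennreal_mult[symmetric])
          (auto simp: real_sqrt_mult exp_add[symmetric] add_divide_distrib)
    qed
  qed measurable
qed

lemma mvn_scaled_identity:
  assumes "0 < \<sigma>"
  shows "mvn n (\<sigma>\<^sup>2 \<cdot>\<^sub>m 1\<^sub>m n) = (\<Pi>\<^sub>M i\<in>{..<n}. gauss \<sigma>)"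
proof -
  have inv: "minv (\<sigma>\<^sup>2 \<cdot>\<^sub>m 1\<^sub>m n) = (1 / \<sigma>\<^sup>2) \<cdot>\<^sub>m 1\<^sub>m n"
  proof (rule minv_eqI[of _ n])
    show "\<sigma>\<^sup>2 \<cdot>\<^sub>m 1\<^sub>m n * ((1 / \<sigma>\<^sup>2) \<cdot>\<^sub>m 1\<^sub>m n) = 1\<^sub>m n"
      using assms by (subst mult_smult_distrib[of _ n n _ n]) auto
  qed auto
  have quad: "(\<Sum>i<n. \<Sum>j<n. x i * (((1 / \<sigma>\<^sup>2) \<cdot>\<^sub>m 1\<^sub>m n) $$ (i, j)) * x j) = dotp n x x / \<sigma>\<^sup>2" for x
  proof -
    have "(\<Sum>i<n. \<Sum>j<n. x i * (((1 / \<sigma>\<^sup>2) \<cdot>\<^sub>m 1\<^sub>m n) $$ (i, j)) * x j)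
       = (\<Sum>i<n. \<Sum>j<n. (if i = j then x i * x j / \<sigma>\<^sup>2 else 0))"
      by (intro sum.cong refl) auto
    also have "\<dots> = dotp n x x / \<sigma>\<^sup>2"
      by (simp add: dotp_def sum_divide_distrib)
    finally show ?thesis .
  qed
  show ?thesis
    unfolding mvn_def inv quad PiM_gauss[OF assms]
    by (simp add: power_mult_distrib mult.commute power2_eq_square power_mult)
qed

lemma nn_integral_normal_density_exp:
  "(\<integral>\<^sup>+x. ennreal (normal_density 0 1 x) * ennreal (exp (a * x)) \<partial>lborel) = ennreal (exp (a\<^sup>2 / 2))"
proof -
  have "normal_density 0 1 x * exp (a * x) = exp (a\<^sup>2 / 2) * normal_density a 1 x" for x
  proof -
    have "- x\<^sup>2 / 2 + a * x = a\<^sup>2 / 2 + - (x - a)\<^sup>2 / 2" by (simp add: power2_eq_square field_simps)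
    then have "exp (- x\<^sup>2 / 2) * exp (a * x) = exp (a\<^sup>2 / 2) * exp (- (x - a)\<^sup>2 / 2)"
      by (metis exp_add)
    then show ?thesis by (simp add: normal_density_def)
  qed
  then have "(\<integral>\<^sup>+x. ennreal (normal_density 0 1 x) * ennreal (exp (a * x)) \<partial>lborel)
      = (\<integral>\<^sup>+x. ennreal (exp (a\<^sup>2 / 2)) * ennreal (normal_density a 1 x) \<partial>lborel)"
    by (simp add: ennreal_mult[symmetric])
  also have "\<dots> = ennreal (exp (a\<^sup>2 / 2)) * (\<integral>\<^sup>+x. ennreal (normal_density a 1 x) \<partial>lborel)"
    by (rule nn_integral_cmult) simp
  also have "(\<integral>\<^sup>+x. ennreal (normal_density a 1 x) \<partial>lborel) = 1"
    by (subst nn_integral_eq_integral) auto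
  finally show ?thesis by simp
qed

lemma nn_integral_gauss_exp:
  "(\<integral>\<^sup>+x. ennreal (exp (a * x)) \<partial>gauss 1) = ennreal (exp (a\<^sup>2 / 2))"
  unfolding gauss_def by (subst nn_integral_density) (auto simp: nn_integral_normal_density_exp)

text \<open>
  The integrand is a multiple of the normal density with variance \<open>\<sigma>\<^sup>2 / (1 - 2 \<sigma>\<^sup>2 h)\<close>.
\<close>

lemma nn_integral_gauss_exp_square:
  assumes s: "0 < \<sigma>" and h: "2 * \<sigma>\<^sup>2 * h < 1"
  shows "(\<integral>\<^sup>+y. ennreal (exp (h * y\<^sup>2)) \<partial>gauss \<sigma>) = ennreal (1 / sqrt (1 - 2 * \<sigma>\<^sup>2 * h))"
proof -
  define r where "r = sqrt (1 - 2 * \<sigma>\<^sup>2 * h)"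
  define v where "v = \<sigma> / r"
  have r: "0 < r" "r\<^sup>2 = 1 - 2 * \<sigma>\<^sup>2 * h" using h by (auto simp: r_def)
  have v: "0 < v" using s r by (simp add: v_def)
  have "normal_density 0 \<sigma> y * exp (h * y\<^sup>2) = 1 / r * normal_density 0 v y" for y
  proof -
    have "- y\<^sup>2 / (2 * \<sigma>\<^sup>2) + h * y\<^sup>2 = - y\<^sup>2 * (1 - 2 * \<sigma>\<^sup>2 * h) / (2 * \<sigma>\<^sup>2)"
      using s by (simp add: field_simps)
    also have "\<dots> = - y\<^sup>2 / (2 * v\<^sup>2)"
      using s r by (simp add: v_def power_divide)
    finally have e: "exp (- y\<^sup>2 / (2 * \<sigma>\<^sup>2)) * exp (h * y\<^sup>2) = exp (- y\<^sup>2 / (2 * v\<^sup>2))"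
      by (metis exp_add)
    have "sqrt (2 * pi * \<sigma>\<^sup>2) = r * sqrt (2 * pi * v\<^sup>2)"
    proof -
      have "r * v = \<sigma>" using r(1) by (simp add: v_def)
      then have "r * (sqrt (2 * pi) * v) = sqrt (2 * pi) * \<sigma>" by simp
      then show ?thesis using s v by (simp only: real_sqrt_mult real_sqrt_abs abs_of_pos)
    qed
    then show ?thesis using e r unfolding normal_density_def by simp
  qed
  then have "(\<integral>\<^sup>+y. ennreal (normal_density 0 \<sigma> y) * ennreal (exp (h * y\<^sup>2)) \<partial>lborel)
      = (\<integral>\<^sup>+y. ennreal (1 / r) * ennreal (normal_density 0 v y) \<partial>lborel)"
    using r by (simp add: ennreal_mult[symmetric])
  also have "\<dots> = ennreal (1 / r) * (\<integral>\<^sup>+y. ennreal (normal_density 0 v y) \<partial>lborel)"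
    by (rule nn_integral_cmult) simp
  also have "(\<integral>\<^sup>+y. ennreal (normal_density 0 v y) \<partial>lborel) = 1"
    using v by (subst nn_integral_eq_integral) auto
  finally have "(\<integral>\<^sup>+y. ennreal (normal_density 0 \<sigma> y) * ennreal (exp (h * y\<^sup>2)) \<partial>lborel) = ennreal (1 / r)"
    by simp
  moreover have "(\<integral>\<^sup>+y. ennreal (exp (h * y\<^sup>2)) \<partial>gauss \<sigma>)
      = (\<integral>\<^sup>+y. ennreal (normal_density 0 \<sigma> y) * ennreal (exp (h * y\<^sup>2)) \<partial>lborel)"
    unfolding gauss_def by (rule nn_integral_density) measurable
  ultimately show ?thesis by (simp only: r_def)
qed

section \<open>Spiked parameters\<close>

text \<open>
  Let \<open>y \<sim> N(0, \<sigma>\<^sup>2)\<close> and let \<open>x\<close> given \<open>y\<close> have law \<open>N(y u, I)\<close>. Then \<open>x\<close> has covariance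
  \<open>I + \<sigma>\<^sup>2 u u\<^sup>T\<close>, and the regression of \<open>y\<close> on \<open>x\<close> has the coefficients and the residual
  deviation below, where \<open>\<kappa> = 1 + \<sigma>\<^sup>2 |u|\<^sup>2\<close>. The null parameter is the case \<open>u = 0\<close>.
\<close>

definition spiked_param :: "nat \<Rightarrow> real \<Rightarrow> (nat \<Rightarrow> real) \<Rightarrow> param" where
  "spiked_param p \<sigma> u = (let \<kappa> = 1 + \<sigma>\<^sup>2 * dotp p u u in
     ((\<lambda>j\<in>{..<p}. \<sigma>\<^sup>2 / \<kappa> * u j), rank1_update p (- (\<sigma>\<^sup>2 / \<kappa>)) u, \<sigma> / sqrt \<kappa>))"

lemma dotp_spiked_param:
  "dotp p \<xi> (fst (spiked_param p \<sigma> u)) = \<sigma>\<^sup>2 / (1 + \<sigma>\<^sup>2 * dotp p u u) * dotp p \<xi> u"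
  unfolding spiked_param_def Let_def fst_conv dotp_def sum_distrib_left
  by (rule sum.cong) auto

lemma kappa_pos: "0 < 1 + \<sigma>\<^sup>2 * dotp p u u"
  using dotp_nonneg[of p u] by (simp add: add_pos_nonneg)

text \<open>
  The scalar equation that makes \<open>I - (\<sigma>\<^sup>2 / \<kappa>) u u\<^sup>T\<close> the inverse of \<open>I + \<sigma>\<^sup>2 u u\<^sup>T\<close>
  (Sherman and Morrison).
\<close>

lemma precision_identity:
  assumes k: "\<kappa> = 1 + \<sigma>\<^sup>2 * dotp p u u"
  shows "- (\<sigma>\<^sup>2 / \<kappa>) + \<sigma>\<^sup>2 + - (\<sigma>\<^sup>2 / \<kappa>) * \<sigma>\<^sup>2 * dotp p u u = 0"
proof -
  have "\<kappa> \<noteq> 0" using kappa_pos[of \<sigma> p u] k by simp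
  moreover have "\<kappa> * (- (\<sigma>\<^sup>2 / \<kappa>) + \<sigma>\<^sup>2 + - (\<sigma>\<^sup>2 / \<kappa>) * \<sigma>\<^sup>2 * dotp p u u)
      = - \<sigma>\<^sup>2 + \<sigma>\<^sup>2 * (\<kappa> - \<sigma>\<^sup>2 * dotp p u u)"
    using \<open>\<kappa> \<noteq> 0\<close> by (simp add: field_simps)
  ultimately show ?thesis using k by simp
qed

lemma minv_precision:
  assumes "\<kappa> = 1 + \<sigma>\<^sup>2 * dotp p u u"
  shows "minv (rank1_update p (- (\<sigma>\<^sup>2 / \<kappa>)) u) = rank1_update p (\<sigma>\<^sup>2) u"
  by (rule minv_rank1_update) (rule precision_identity[OF assms])

lemma mvn_covariance:
  assumes k: "\<kappa> = 1 + \<sigma>\<^sup>2 * dotp p u u"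
  shows "mvn p (minv (rank1_update p (- (\<sigma>\<^sup>2 / \<kappa>)) u)) = density (\<Pi>\<^sub>M j\<in>{..<p}. gauss 1)
     (\<lambda>x. ennreal (exp (\<sigma>\<^sup>2 / \<kappa> * (dotp p u x)\<^sup>2 / 2) / sqrt \<kappa>))"
  using mvn_rank1_update[OF precision_identity[OF k] kappa_pos]
  unfolding minv_precision[OF k] k[symmetric] by simp

text \<open>
  The eigenvalues of the precision matrix are among \<open>1\<close> and \<open>1 / \<kappa>\<close>, and the residual deviation is at
  most \<open>\<sigma>\<close> as \<open>\<kappa> \<ge> 1\<close>.
\<close>

lemma spiked_param_in_Theta:
  assumes p: "1 \<le> p" and \<sigma>: "0 < \<sigma>" "\<sigma> \<le> M2" and M1: "1 + \<sigma>\<^sup>2 * dotp p u u \<le> M1"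
    and k: "card {j. j < p \<and> u j \<noteq> 0} \<le> k"
  shows "spiked_param p \<sigma> u \<in> Theta p M1 M2 k"
proof -
  define \<kappa> where "\<kappa> = 1 + \<sigma>\<^sup>2 * dotp p u u"
  have k1: "1 \<le> \<kappa>" using dotp_nonneg[of p u] by (simp add: \<kappa>_def)
  have kM: "\<kappa> \<le> M1" using M1 by (simp add: \<kappa>_def)
  let ?\<Omega> = "rank1_update p (- (\<sigma>\<^sup>2 / \<kappa>)) u"
  let ?\<beta> = "\<lambda>j\<in>{..<p}. \<sigma>\<^sup>2 / \<kappa> * u j"
  have eig: "1 + - (\<sigma>\<^sup>2 / \<kappa>) * dotp p u u = 1 / \<kappa>"
    using k1 by (simp add: \<kappa>_def field_simps)
  have spec: "spectrum ?\<Omega> \<noteq> {} \<and> spectrum ?\<Omega> \<subseteq> {1, 1 / \<kappa>}"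
  proof (cases "\<exists>l<p. u l \<noteq> 0")
    case True
    then obtain l where l: "l < p" "u l \<noteq> 0" by auto
    from spectrum_rank1_update[where s = u and p = p and l = l and c = "- (\<sigma>\<^sup>2 / \<kappa>)"] l show ?thesis unfolding eig by blast
  next
    case False
    have "?\<Omega> = rank1_update p 0 (\<lambda>_. 1)"
      by (rule eq_matI) (use False in auto)
    moreover have "1 \<in> spectrum (rank1_update p 0 (\<lambda>_. 1))" "spectrum (rank1_update p 0 (\<lambda>_. 1)) \<subseteq> {1}"
      using spectrum_rank1_update[of 0 p "\<lambda>_. 1" 0] p by auto
    ultimately show ?thesis by auto
  qed
  then have fin: "finite (spectrum ?\<Omega>)" by (auto intro: finite_subset)
  have "1 / \<kappa> \<le> 1" using k1 by simp
  have lo: "1 / M1 \<le> x" and hi: "x \<le> M1" if "x \<in> spectrum ?\<Omega>" for x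
  proof -
    have "1 / M1 \<le> 1 / \<kappa>" using k1 kM by (intro divide_left_mono) auto
    moreover have "x = 1 \<or> x = 1 / \<kappa>" using spec that by blast
    ultimately show "1 / M1 \<le> x" "x \<le> M1" using \<open>1 / \<kappa> \<le> 1\<close> k1 kM by linarith+
  qed
  have "{j. j < p \<and> ?\<beta> j \<noteq> 0} \<subseteq> {j. j < p \<and> u j \<noteq> 0}" by auto
  then have "card {j. j < p \<and> ?\<beta> j \<noteq> 0} \<le> card {j. j < p \<and> u j \<noteq> 0}"
    by (intro card_mono) auto
  then have "norm0 p ?\<beta> \<le> k" using k by (simp add: norm0_def supp_def)
  moreover have "transpose_mat ?\<Omega> = ?\<Omega>" by (rule eq_matI) auto
  moreover have "1 / M1 \<le> lambda_min ?\<Omega>" "lambda_min ?\<Omega> \<le> lambda_max ?\<Omega>" "lambda_max ?\<Omega> \<le> M1"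
    unfolding lambda_min_def lambda_max_def using fin spec lo hi
    by (auto simp: Min_ge_iff Max_le_iff intro: order.trans[OF Min_le Max_ge])
  moreover have "0 < \<sigma> / sqrt \<kappa>" using \<sigma> k1 by simp
  moreover have "\<sigma> / sqrt \<kappa> \<le> M2"
  proof -
    have "\<sigma> / sqrt \<kappa> \<le> \<sigma> / 1" using \<sigma> k1 by (intro divide_left_mono) auto
    then show ?thesis using \<sigma> by simp
  qed
  moreover have "?\<beta> \<in> Rn p" by auto
  ultimately show ?thesis
    by (simp add: Theta_def spiked_param_def Let_def \<kappa>_def[symmetric])
qed

section \<open>The law of the sample as a product over the observations\<close>

abbreviation row_space :: "nat \<Rightarrow> (real \<times> (nat \<Rightarrow> real)) measure" where
  "row_space p \<equiv> borel \<Otimes>\<^sub>M (\<Pi>\<^sub>M j\<in>{..<p}. borel)"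

definition row_law :: "nat \<Rightarrow> param \<Rightarrow> (real \<times> (nat \<Rightarrow> real)) measure" where
  "row_law p = (\<lambda>(\<beta>, \<Omega>, \<sigma>). distr (mvn p (minv \<Omega>) \<Otimes>\<^sub>M gauss \<sigma>) (row_space p)
     (\<lambda>(x, e). (dotp p x \<beta> + e, x)))"

text \<open>
  The map that produces the sample acts on each index \<open>i\<close> separately, so the law of the pairs
  \<open>(y\<^sub>i, X\<^sub>i)\<close> is a product. On a box the integral over the noise factorizes for every fixed \<open>X\<close>, and
  the integral over \<open>X\<close> of the resulting product factorizes again.
\<close>

lemma law_eq_PiM_row_law:
  assumes s: "0 < \<sigma>" and G: "sigma_finite_measure (mvn p (minv \<Omega>))"
    and R: "sigma_finite_measure (row_law p (\<beta>, \<Omega>, \<sigma>))"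
  shows "law n p (\<beta>, \<Omega>, \<sigma>) = (\<Pi>\<^sub>M i\<in>{..<n}. row_law p (\<beta>, \<Omega>, \<sigma>))"
proof -
  let ?G = "mvn p (minv \<Omega>)"
  let ?R = "row_law p (\<beta>, \<Omega>, \<sigma>)"
  interpret N: prob_space "gauss \<sigma>" by (rule prob_space_gauss[OF s])
  interpret G: sigma_finite_measure ?G by (rule G)
  interpret R: product_sigma_finite "\<lambda>_::nat. ?R" by (simp add: product_sigma_finite_def R)
  interpret PN: product_sigma_finite "\<lambda>_::nat. gauss \<sigma>"
    by (simp add: product_sigma_finite_def N.sigma_finite_measure_axioms)
  interpret PG: product_sigma_finite "\<lambda>_::nat. ?G" by (simp add: product_sigma_finite_def G)
  interpret NN: prob_space "\<Pi>\<^sub>M i\<in>{..<n}. gauss \<sigma>" by (rule prob_space_PiM_gauss[OF s])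
  have setsR [simp]: "sets ?R = sets (row_space p)" by (simp add: row_law_def)
  let ?f = "\<lambda>(X, \<epsilon>). \<lambda>i\<in>{..<n}. (dotp p (X i) \<beta> + \<epsilon> i, X i)"
  let ?P = "(\<Pi>\<^sub>M i\<in>{..<n}. ?G) \<Otimes>\<^sub>M (\<Pi>\<^sub>M i\<in>{..<n}. gauss \<sigma>)"
  have f: "?f \<in> measurable ?P (obs_space n p)"
    unfolding obs_space_def by measurable
  have L: "law n p (\<beta>, \<Omega>, \<sigma>) = distr ?P (obs_space n p) ?f"
    unfolding law_def by (simp add: mvn_scaled_identity[OF s])
  show ?thesis
    unfolding L
  proof (rule R.PiM_eqI)
    show "sets (distr ?P (obs_space n p) ?f) = sets (\<Pi>\<^sub>M i\<in>{..<n}. ?R)"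
      unfolding obs_space_def sets_distr by (rule sets_PiM_cong) auto
    fix A assume "\<And>i. i \<in> {..<n} \<Longrightarrow> A i \<in> sets ?R"
    then have A [measurable]: "i \<in> {..<n} \<Longrightarrow> A i \<in> sets (row_space p)" for i by auto
    define h :: "nat \<Rightarrow> (nat \<Rightarrow> real) \<Rightarrow> real \<Rightarrow> ennreal"
      where "h i x e = indicator (A i) (dotp p x \<beta> + e, x)" for i x e
    have hm [measurable]: "case_prod (h i) \<in> borel_measurable (?G \<Otimes>\<^sub>M gauss \<sigma>)" if "i < n" for i
    proof -
      have [measurable]: "A i \<in> sets (row_space p)" using A that by simp
      show ?thesis unfolding h_def by measurable
    qed
    have hm2 [measurable]: "h i x \<in> borel_measurable (gauss \<sigma>)" if "i < n" "x \<in> space ?G" for i x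
      using measurable_Pair2[OF hm[OF that(1)] that(2)] by simp
    have box: "Pi\<^sub>E {..<n} A \<in> sets (obs_space n p)"
      unfolding obs_space_def by (rule sets_PiM_I_finite) (use A in auto)
    have "emeasure (distr ?P (obs_space n p) ?f) (Pi\<^sub>E {..<n} A)
      = (\<integral>\<^sup>+z. indicator (Pi\<^sub>E {..<n} A) z \<partial>distr ?P (obs_space n p) ?f)"
      using box by simp
    also have "\<dots> = (\<integral>\<^sup>+w. indicator (Pi\<^sub>E {..<n} A) (?f w) \<partial>?P)"
      by (rule nn_integral_distr[OF f]) (use box in measurable)
    also have "\<dots> = (\<integral>\<^sup>+w. (\<Prod>i<n. h i (fst w i) (snd w i)) \<partial>?P)"
    proof (rule nn_integral_cong)
      fix w
      show "indicator (Pi\<^sub>E {..<n} A) (?f w) = (\<Prod>i<n. h i (fst w i) (snd w i))"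
      proof (cases "\<forall>i<n. (dotp p (fst w i) \<beta> + snd w i, fst w i) \<in> A i")
        case True
        then have "?f w \<in> Pi\<^sub>E {..<n} A" by (auto simp: case_prod_unfold PiE_iff)
        then show ?thesis using True by (simp add: h_def)
      next
        case False
        then obtain i where i: "i < n" "(dotp p (fst w i) \<beta> + snd w i, fst w i) \<notin> A i" by auto
        then have "?f w \<notin> Pi\<^sub>E {..<n} A" by (force simp: case_prod_unfold PiE_iff)
        moreover have "(\<Prod>i<n. h i (fst w i) (snd w i)) = 0"
          using i by (intro prod_zero bexI[of _ i]) (auto simp: h_def)
        ultimately show ?thesis by simp
      qed
    qed
    also have "\<dots> = (\<integral>\<^sup>+X. \<integral>\<^sup>+\<epsilon>. (\<Prod>i<n. h i (X i) (\<epsilon> i)) \<partial>(\<Pi>\<^sub>M i\<in>{..<n}. gauss \<sigma>) \<partial>(\<Pi>\<^sub>M i\<in>{..<n}. ?G))"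
    proof (subst NN.nn_integral_fst[symmetric])
      have "(\<lambda>w. h i (fst w i) (snd w i)) \<in> borel_measurable ?P" if "i < n" for i
      proof -
        have "(\<lambda>w. (fst w i, snd w i)) \<in> measurable ?P (?G \<Otimes>\<^sub>M gauss \<sigma>)"
          by (intro measurable_Pair measurable_compose[OF measurable_fst] measurable_compose[OF measurable_snd]
              measurable_component_singleton) (use that in auto)
        from measurable_compose[OF this hm[OF that]] show ?thesis by simp
      qed
      then show "(\<lambda>w. \<Prod>i<n. h i (fst w i) (snd w i)) \<in> borel_measurable ?P"
        by (intro borel_measurable_prod_ennreal) auto
    qed simp
    also have "\<dots> = (\<integral>\<^sup>+X. (\<Prod>i<n. \<integral>\<^sup>+e. h i (X i) e \<partial>gauss \<sigma>) \<partial>(\<Pi>\<^sub>M i\<in>{..<n}. ?G))"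
      by (rule nn_integral_cong, rule PN.product_nn_integral_prod) (auto intro!: hm2 simp: space_PiM PiE_iff)
    also have "\<dots> = (\<Prod>i<n. \<integral>\<^sup>+x. \<integral>\<^sup>+e. h i x e \<partial>gauss \<sigma> \<partial>?G)"
      by (rule PG.product_nn_integral_prod) (auto intro!: N.borel_measurable_nn_integral hm)
    also have "\<dots> = (\<Prod>i<n. emeasure ?R (A i))"
    proof (rule prod.cong)
      fix i assume "i \<in> {..<n}"
      then have i: "i < n" and Ai [measurable]: "A i \<in> sets (row_space p)" using A by auto
      have "emeasure ?R (A i) = (\<integral>\<^sup>+z. indicator (A i) z \<partial>?R)" using Ai by simp
      also have "\<dots> = (\<integral>\<^sup>+w. case_prod (h i) w \<partial>(?G \<Otimes>\<^sub>M gauss \<sigma>))"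
        unfolding row_law_def case_prod_conv
        by (subst nn_integral_distr) (auto simp: h_def case_prod_unfold)
      also have "\<dots> = (\<integral>\<^sup>+x. \<integral>\<^sup>+e. h i x e \<partial>gauss \<sigma> \<partial>?G)"
        using N.nn_integral_fst[OF hm[OF i]] by simp
      finally show "(\<integral>\<^sup>+x. \<integral>\<^sup>+e. h i x e \<partial>gauss \<sigma> \<partial>?G) = emeasure ?R (A i)" by simp
    qed simp
    finally show "emeasure (distr ?P (obs_space n p) ?f) (Pi\<^sub>E {..<n} A) = (\<Prod>i\<in>{..<n}. emeasure ?R (A i))" .
  qed simp
qed

section \<open>Likelihood ratios of the spiked parameters\<close>

definition null_row :: "nat \<Rightarrow> real \<Rightarrow> (real \<times> (nat \<Rightarrow> real)) measure" where
  "null_row p \<sigma> = gauss \<sigma> \<Otimes>\<^sub>M (\<Pi>\<^sub>M j\<in>{..<p}. gauss 1)"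

text \<open>
  For \<open>z = (y, x)\<close> this is the density at \<open>x\<close> of \<open>N(y u, I)\<close> with respect to \<open>N(0, I)\<close>.
\<close>

definition row_lr :: "nat \<Rightarrow> (nat \<Rightarrow> real) \<Rightarrow> real \<times> (nat \<Rightarrow> real) \<Rightarrow> real" where
  "row_lr p u = (\<lambda>(y, x). exp (y * dotp p u x - y\<^sup>2 * dotp p u u / 2))"

lemma sets_null_row [measurable_cong, simp]: "sets (null_row p \<sigma>) = sets (row_space p)"
  unfolding null_row_def by (rule sets_pair_measure_cong) auto

lemma measurable_row_lr [measurable]: "row_lr p u \<in> borel_measurable (row_space p)"
  unfolding row_lr_def by measurable

lemma row_lr_nonneg [simp]: "0 \<le> row_lr p u z"
  by (simp add: row_lr_def split: prod.split)

lemma prob_space_null_row: "0 < \<sigma> \<Longrightarrow> prob_space (null_row p \<sigma>)"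
proof -
  assume s: "0 < \<sigma>"
  interpret A: prob_space "gauss \<sigma>" by (rule prob_space_gauss[OF s])
  interpret B: prob_space "\<Pi>\<^sub>M j\<in>{..<p}. gauss 1" by (rule prob_space_PiM_gauss) simp
  interpret pair_prob_space "gauss \<sigma>" "\<Pi>\<^sub>M j\<in>{..<p}. gauss 1" ..
  show ?thesis unfolding null_row_def by (rule prob_space_axioms)
qed

text \<open>
  The heart of the second moment computation. For fixed \<open>y\<close> the product of the two ratios is the
  exponential of an affine function of \<open>x\<close>, so the integral over \<open>x\<close> is a product of one-dimensional
  moment generating functions. The squares of \<open>u\<close> and \<open>v\<close> cancel and \<open>exp (y\<^sup>2 \<langle>u, v\<rangle>)\<close> is
  left to be integrated over \<open>y\<close>.
\<close>

lemma nn_integral_row_lr_product: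
  assumes s: "0 < \<sigma>" and h: "2 * \<sigma>\<^sup>2 * dotp p u v < 1"
  shows "(\<integral>\<^sup>+z. ennreal (row_lr p u z * row_lr p v z) \<partial>null_row p \<sigma>)
    = ennreal (1 / sqrt (1 - 2 * \<sigma>\<^sup>2 * dotp p u v))"
proof -
  interpret A: prob_space "gauss \<sigma>" by (rule prob_space_gauss[OF s])
  interpret G: prob_space "gauss 1" by (rule prob_space_gauss) simp
  interpret B: prob_space "\<Pi>\<^sub>M j\<in>{..<p}. gauss 1" by (rule prob_space_PiM_gauss) simp
  interpret P: product_sigma_finite "\<lambda>_::nat. gauss 1"
    by (simp add: product_sigma_finite_def G.sigma_finite_measure_axioms)
  have inner: "(\<integral>\<^sup>+x. ennreal (row_lr p u (y, x) * row_lr p v (y, x)) \<partial>(\<Pi>\<^sub>M j\<in>{..<p}. gauss 1))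
     = ennreal (exp (dotp p u v * y\<^sup>2))" for y
  proof -
    have "row_lr p u (y, x) * row_lr p v (y, x)
       = exp (- y\<^sup>2 * (dotp p u u + dotp p v v) / 2) * (\<Prod>j<p. exp (y * (u j + v j) * x j))" for x
    proof -
      have "(\<Sum>j<p. y * (u j + v j) * x j) = y * dotp p u x + y * dotp p v x"
        unfolding dotp_def sum_distrib_left sum.distrib[symmetric]
        by (rule sum.cong) (auto simp: algebra_simps)
      then have "(y * dotp p u x - y\<^sup>2 * dotp p u u / 2) + (y * dotp p v x - y\<^sup>2 * dotp p v v / 2)
          = - y\<^sup>2 * (dotp p u u + dotp p v v) / 2 + (\<Sum>j<p. y * (u j + v j) * x j)"
        unfolding distrib_left[of _ _ "dotp p v v"] add_divide_distrib minus_mult_left[symmetric] by simp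
      then show ?thesis
        unfolding row_lr_def case_prod_conv exp_sum[OF finite_lessThan, symmetric] exp_add[symmetric]
        by (rule arg_cong)
    qed
    then have "ennreal (row_lr p u (y, x) * row_lr p v (y, x))
       = ennreal (exp (- y\<^sup>2 * (dotp p u u + dotp p v v) / 2))
            * (\<Prod>j<p. ennreal (exp (y * (u j + v j) * x j)))" for x
      by (simp only: prod_ennreal[OF exp_ge_zero] ennreal_mult'[OF exp_ge_zero])
    then have "(\<integral>\<^sup>+x. ennreal (row_lr p u (y, x) * row_lr p v (y, x)) \<partial>(\<Pi>\<^sub>M j\<in>{..<p}. gauss 1))
       = (\<integral>\<^sup>+x. ennreal (exp (- y\<^sup>2 * (dotp p u u + dotp p v v) / 2))
            * (\<Prod>j<p. ennreal (exp (y * (u j + v j) * x j))) \<partial>(\<Pi>\<^sub>M j\<in>{..<p}. gauss 1))"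
      by (rule nn_integral_cong)
    also have "\<dots> = ennreal (exp (- y\<^sup>2 * (dotp p u u + dotp p v v) / 2))
            * (\<integral>\<^sup>+x. (\<Prod>j<p. ennreal (exp (y * (u j + v j) * x j))) \<partial>(\<Pi>\<^sub>M j\<in>{..<p}. gauss 1))"
      by (rule nn_integral_cmult) measurable
    also have "(\<integral>\<^sup>+x. (\<Prod>j<p. ennreal (exp (y * (u j + v j) * x j))) \<partial>(\<Pi>\<^sub>M j\<in>{..<p}. gauss 1))
        = (\<Prod>j<p. ennreal (exp ((y * (u j + v j))\<^sup>2 / 2)))"
      by (subst P.product_nn_integral_prod) (auto simp: nn_integral_gauss_exp)
    also have "\<dots> = ennreal (exp (\<Sum>j<p. (y * (u j + v j))\<^sup>2 / 2))"
      by (simp add: prod_ennreal exp_sum)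
    also have "(\<Sum>j<p. (y * (u j + v j))\<^sup>2 / 2)
        = y\<^sup>2 * (dotp p u u + dotp p v v) / 2 + dotp p u v * y\<^sup>2"
      unfolding dotp_def sum.distrib[symmetric] sum_distrib_left sum_divide_distrib sum_distrib_right
    proof (rule sum.cong)
      fix j
      show "(y * (u j + v j))\<^sup>2 / 2 = y\<^sup>2 * (u j * u j + v j * v j) / 2 + u j * v j * y\<^sup>2"
        by (simp add: power2_eq_square algebra_simps add_divide_distrib)
    qed simp
    finally show ?thesis
      by (simp add: ennreal_mult[symmetric] exp_add[symmetric])
  qed
  have "(\<integral>\<^sup>+z. ennreal (row_lr p u z * row_lr p v z) \<partial>null_row p \<sigma>)
     = (\<integral>\<^sup>+y. \<integral>\<^sup>+x. ennreal (row_lr p u (y, x) * row_lr p v (y, x)) \<partial>(\<Pi>\<^sub>M j\<in>{..<p}. gauss 1) \<partial>gauss \<sigma>)"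
    unfolding null_row_def by (rule B.nn_integral_fst[symmetric]) measurable
  also have "\<dots> = ennreal (1 / sqrt (1 - 2 * \<sigma>\<^sup>2 * dotp p u v))"
    unfolding inner by (rule nn_integral_gauss_exp_square[OF s h])
  finally show ?thesis .
qed

lemma nn_integral_row_lr:
  assumes "0 < \<sigma>"
  shows "(\<integral>\<^sup>+z. ennreal (row_lr p u z) \<partial>null_row p \<sigma>) = 1"
  using nn_integral_row_lr_product[OF assms, of p u "\<lambda>_. 0"]
  by (simp add: row_lr_def dotp_def case_prod_unfold)

lemma prob_space_density_row_lr:
  assumes "0 < \<sigma>"
  shows "prob_space (density (null_row p \<sigma>) (\<lambda>z. ennreal (row_lr p u z)))"
proof (rule prob_spaceI)
  have "emeasure (density (null_row p \<sigma>) (\<lambda>z. ennreal (row_lr p u z))) (space (null_row p \<sigma>))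
     = (\<integral>\<^sup>+z. ennreal (row_lr p u z) * indicator (space (null_row p \<sigma>)) z \<partial>null_row p \<sigma>)"
    by (intro emeasure_density sets.top) measurable
  also have "\<dots> = (\<integral>\<^sup>+z. ennreal (row_lr p u z) \<partial>null_row p \<sigma>)"
    by (rule nn_integral_cong) auto
  finally show "emeasure (density (null_row p \<sigma>) (\<lambda>z. ennreal (row_lr p u z)))
     (space (density (null_row p \<sigma>) (\<lambda>z. ennreal (row_lr p u z)))) = 1"
    by (simp add: nn_integral_row_lr[OF assms])
qed

text \<open>
  Two factorizations of the joint density of \<open>(y, x)\<close>, divided by the standard normal density at
  \<open>x\<close>: the left side is the law of \<open>x\<close> times that of \<open>y\<close> given \<open>x\<close>, the right side the law of
  \<open>y\<close> times that of \<open>x\<close> given \<open>y\<close>.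
\<close>

lemma normal_density_shift_rank1:
  fixes \<sigma> :: real
  assumes s: "0 < \<sigma>" and \<kappa>: "\<kappa> = 1 + \<sigma>\<^sup>2 * dotp p u u"
  shows "exp (\<sigma>\<^sup>2 / \<kappa> * (dotp p u x)\<^sup>2 / 2) / sqrt \<kappa>
       * normal_density 0 (\<sigma> / sqrt \<kappa>) (y - \<sigma>\<^sup>2 / \<kappa> * dotp p u x)
     = normal_density 0 \<sigma> y * row_lr p u (y, x)"
proof -
  have \<kappa>1: "0 < \<kappa>" using dotp_nonneg[of p u] \<kappa> by (simp add: add_pos_nonneg)
  define q where "q = dotp p u x"
  define m where "m = dotp p u u"
  have km: "\<kappa> = 1 + \<sigma>\<^sup>2 * m" using \<kappa> by (simp add: m_def)
  have sq: "(\<sigma> / sqrt \<kappa>)\<^sup>2 = \<sigma>\<^sup>2 / \<kappa>" using \<kappa>1 by (simp add: power_divide)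
  have e: "\<sigma>\<^sup>2 / \<kappa> * q\<^sup>2 / 2 + - (y - \<sigma>\<^sup>2 / \<kappa> * q)\<^sup>2 / (2 * (\<sigma>\<^sup>2 / \<kappa>))
      = - y\<^sup>2 / (2 * \<sigma>\<^sup>2) + (y * q - y\<^sup>2 * m / 2)"
  proof -
    have "- (y - \<sigma>\<^sup>2 / \<kappa> * q)\<^sup>2 / (2 * (\<sigma>\<^sup>2 / \<kappa>)) = - y\<^sup>2 * \<kappa> / (2 * \<sigma>\<^sup>2) + y * q - \<sigma>\<^sup>2 / \<kappa> * q\<^sup>2 / 2"
      using s \<kappa>1 by (simp add: power2_eq_square field_simps)
    moreover have "- y\<^sup>2 * \<kappa> / (2 * \<sigma>\<^sup>2) = - y\<^sup>2 / (2 * \<sigma>\<^sup>2) - y\<^sup>2 * m / 2"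
      using s by (simp add: km field_simps)
    ultimately show ?thesis by simp
  qed
  have "sqrt \<kappa> * sqrt (2 * pi * (\<sigma>\<^sup>2 / \<kappa>)) = sqrt (2 * pi * \<sigma>\<^sup>2)"
    using \<kappa>1 by (simp add: real_sqrt_mult[symmetric])
  then show ?thesis
    unfolding normal_density_def row_lr_def sq q_def[symmetric] m_def[symmetric] case_prod_conv
    using arg_cong[OF e, of exp] \<kappa>1 by (simp add: exp_add[symmetric] field_simps) 
qed

text \<open>
  The map that adds \<open>x\<^sup>T \<beta>\<close> to the noise is a translation of the first coordinate for every fixed
  \<open>x\<close>; translation invariance of Lebesgue measure turns it into a shift of the noise density, to which
  the preceding identity applies.
\<close>

lemma row_law_spiked_param:
  assumes s: "0 < \<sigma>"
  shows "row_law p (spiked_param p \<sigma> u) = density (null_row p \<sigma>) (\<lambda>z. ennreal (row_lr p u z))"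
proof -
  define \<kappa> where k: "\<kappa> = 1 + \<sigma>\<^sup>2 * dotp p u u"
  have kpos: "0 < \<kappa>" using kappa_pos k by simp
  define \<beta> where "\<beta> = (\<lambda>j\<in>{..<p}. \<sigma>\<^sup>2 / \<kappa> * u j)"
  define v where "v = \<sigma> / sqrt \<kappa>"
  have v: "0 < v" using s kpos by (simp add: v_def)
  define W where "W x = exp (\<sigma>\<^sup>2 / \<kappa> * (dotp p u x)\<^sup>2 / 2) / sqrt \<kappa>" for x
  let ?PG = "\<Pi>\<^sub>M j\<in>{..<p}. gauss 1"
  let ?G = "density ?PG (\<lambda>x. ennreal (W x))"
  have W0: "0 \<le> W x" for x using kpos by (simp add: W_def)
  have W [measurable]: "W \<in> borel_measurable (\<Pi>\<^sub>M j\<in>{..<p}. borel)" unfolding W_def by measurable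
  have \<beta>: "dotp p x \<beta> = \<sigma>\<^sup>2 / \<kappa> * dotp p u x" for x
    unfolding \<beta>_def dotp_def sum_distrib_left by (rule sum.cong) auto
  interpret A: prob_space "gauss \<sigma>" by (rule prob_space_gauss[OF s])
  interpret V: prob_space "gauss v" by (rule prob_space_gauss[OF v])
  interpret B: prob_space ?PG by (rule prob_space_PiM_gauss) simp
  interpret AB: pair_sigma_finite "gauss \<sigma>" ?PG ..
  have law: "row_law p (spiked_param p \<sigma> u) = distr (?G \<Otimes>\<^sub>M gauss v) (row_space p) (\<lambda>(x, e). (dotp p x \<beta> + e, x))"
    unfolding row_law_def spiked_param_def Let_def k[symmetric] case_prod_conv mvn_covariance[OF k]
      W_def[symmetric] \<beta>_def[symmetric] v_def[symmetric] ..
  show ?thesis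
    unfolding law
  proof (rule measure_eqI)
    fix S assume "S \<in> sets (distr (?G \<Otimes>\<^sub>M gauss v) (row_space p) (\<lambda>(x, e). (dotp p x \<beta> + e, x)))"
    then have S [measurable]: "S \<in> sets (row_space p)" by simp
    have lhs: "emeasure (distr (?G \<Otimes>\<^sub>M gauss v) (row_space p) (\<lambda>(x, e). (dotp p x \<beta> + e, x))) S
        = (\<integral>\<^sup>+z. indicator S z \<partial>distr (?G \<Otimes>\<^sub>M gauss v) (row_space p) (\<lambda>(x, e). (dotp p x \<beta> + e, x)))"
      using S by simp
    also have "\<dots> = (\<integral>\<^sup>+w. indicator S (dotp p (fst w) \<beta> + snd w, fst w) \<partial>(?G \<Otimes>\<^sub>M gauss v))"
      by (subst nn_integral_distr) (auto simp: case_prod_unfold)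
    also have "\<dots> = (\<integral>\<^sup>+x. \<integral>\<^sup>+e. indicator S (dotp p x \<beta> + e, x) \<partial>gauss v \<partial>?G)"
      by (subst V.nn_integral_fst[symmetric]) auto
    also have "\<dots> = (\<integral>\<^sup>+x. ennreal (W x) * (\<integral>\<^sup>+e. indicator S (dotp p x \<beta> + e, x) \<partial>gauss v) \<partial>?PG)"
      by (rule nn_integral_density) measurable
    also have "\<dots> = (\<integral>\<^sup>+x. \<integral>\<^sup>+y. ennreal (row_lr p u (y, x)) * indicator S (y, x) \<partial>gauss \<sigma> \<partial>?PG)"
    proof (rule nn_integral_cong)
      fix x assume x: "x \<in> space ?PG"
      then have x': "x \<in> space (\<Pi>\<^sub>M j\<in>{..<p}. borel)" by (simp add: space_PiM gauss_def)
      have [measurable]: "(\<lambda>y. indicator S (y, x) :: ennreal) \<in> borel_measurable borel"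
        using x' by measurable
      have [measurable]: "(\<lambda>y. row_lr p u (y, x)) \<in> borel_measurable borel"
        using x' by measurable
      have "ennreal (W x) * (\<integral>\<^sup>+e. indicator S (dotp p x \<beta> + e, x) \<partial>gauss v)
         = ennreal (W x) * (\<integral>\<^sup>+e. ennreal (normal_density 0 v e) * indicator S (dotp p x \<beta> + e, x) \<partial>lborel)"
        unfolding gauss_def by (subst nn_integral_density) auto
      also have "(\<integral>\<^sup>+e. ennreal (normal_density 0 v e) * indicator S (dotp p x \<beta> + e, x) \<partial>lborel)
         = (\<integral>\<^sup>+y. ennreal (normal_density 0 v (y - dotp p x \<beta>)) * indicator S (y, x) \<partial>lborel)"
        \<comment> \<open>Substitution \<open>e = y - x\<^sup>T \<beta>\<close>.\<close>
        by (subst nn_integral_real_affine[where c = 1 and t = "- dotp p x \<beta>"]) auto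
      also have "ennreal (W x) * \<dots>
         = (\<integral>\<^sup>+y. ennreal (W x) * (ennreal (normal_density 0 v (y - dotp p x \<beta>)) * indicator S (y, x)) \<partial>lborel)"
        by (rule nn_integral_cmult[symmetric]) measurable
      also have "\<dots> = (\<integral>\<^sup>+y. ennreal (normal_density 0 \<sigma> y) * (ennreal (row_lr p u (y, x)) * indicator S (y, x)) \<partial>lborel)"
      proof (rule nn_integral_cong)
        fix y
        have "ennreal (W x) * ennreal (normal_density 0 v (y - dotp p x \<beta>))
            = ennreal (normal_density 0 \<sigma> y) * ennreal (row_lr p u (y, x))"
          using normal_density_shift_rank1[OF s k, of x y] W0[of x]
          by (simp add: ennreal_mult[symmetric] W_def v_def \<beta>)
        then show "ennreal (W x) * (ennreal (normal_density 0 v (y - dotp p x \<beta>)) * indicator S (y, x))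
            = ennreal (normal_density 0 \<sigma> y) * (ennreal (row_lr p u (y, x)) * indicator S (y, x))"
          by (simp only: mult.assoc[symmetric])
      qed
      also have "\<dots> = (\<integral>\<^sup>+y. ennreal (row_lr p u (y, x)) * indicator S (y, x) \<partial>gauss \<sigma>)"
        unfolding gauss_def by (subst nn_integral_density) auto
      finally show "ennreal (W x) * (\<integral>\<^sup>+e. indicator S (dotp p x \<beta> + e, x) \<partial>gauss v)
         = (\<integral>\<^sup>+y. ennreal (row_lr p u (y, x)) * indicator S (y, x) \<partial>gauss \<sigma>)" .
    qed
    also have "\<dots> = (\<integral>\<^sup>+z. ennreal (row_lr p u z) * indicator S z \<partial>null_row p \<sigma>)"
      unfolding null_row_def by (rule AB.nn_integral_snd) measurable
    also have "\<dots> = emeasure (density (null_row p \<sigma>) (\<lambda>z. ennreal (row_lr p u z))) S"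
      by (rule emeasure_density[symmetric]) measurable
    finally show "emeasure (distr (?G \<Otimes>\<^sub>M gauss v) (row_space p) (\<lambda>(x, e). (dotp p x \<beta> + e, x))) S
       = emeasure (density (null_row p \<sigma>) (\<lambda>z. ennreal (row_lr p u z))) S" .
  qed simp
qed

definition null_law :: "nat \<Rightarrow> nat \<Rightarrow> real \<Rightarrow> obs measure" where
  "null_law n p \<sigma> = (\<Pi>\<^sub>M i\<in>{..<n}. null_row p \<sigma>)"

lemma law_spiked_param:
  assumes s: "0 < \<sigma>"
  shows "law n p (spiked_param p \<sigma> u)
    = density (null_law n p \<sigma>) (\<lambda>z. ennreal (\<Prod>i<n. row_lr p u (z i)))"
proof -
  interpret N: prob_space "null_row p \<sigma>" by (rule prob_space_null_row[OF s])
  interpret D: prob_space "density (null_row p \<sigma>) (\<lambda>z. ennreal (row_lr p u z))"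
    by (rule prob_space_density_row_lr[OF s])
  define \<kappa> where k: "\<kappa> = 1 + \<sigma>\<^sup>2 * dotp p u u"
  have kpos: "0 < \<kappa>" using kappa_pos k by simp
  have G: "sigma_finite_measure (mvn p (minv (rank1_update p (- (\<sigma>\<^sup>2 / \<kappa>)) u)))"
    unfolding mvn_covariance[OF k]
    by (rule sigma_finite_density_real) (auto intro: prob_space_PiM_gauss)
  have R: "sigma_finite_measure (row_law p (spiked_param p \<sigma> u))"
    unfolding row_law_spiked_param[OF s] by (rule D.sigma_finite_measure_axioms)
  have "law n p (spiked_param p \<sigma> u) = (\<Pi>\<^sub>M i\<in>{..<n}. row_law p (spiked_param p \<sigma> u))"
    using R unfolding spiked_param_def Let_def k[symmetric]
    by (intro law_eq_PiM_row_law G) (use s kpos in auto)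
  also have "\<dots> = density (null_law n p \<sigma>) (\<lambda>z. \<Prod>i<n. ennreal (row_lr p u (z i)))"
    unfolding row_law_spiked_param[OF s] null_law_def
    by (rule PiM_density_same[symmetric])
       (auto intro: N.sigma_finite_measure_axioms D.sigma_finite_measure_axioms)
  finally show ?thesis by (simp add: prod_ennreal)
qed

lemma null_law_eq_law:
  assumes "0 < \<sigma>"
  shows "law n p (spiked_param p \<sigma> (\<lambda>_. 0)) = null_law n p \<sigma>"
  unfolding law_spiked_param[OF assms]
  by (simp add: row_lr_def dotp_def case_prod_unfold density_1)

lemma nn_integral_lr_product:
  assumes s: "0 < \<sigma>" and h: "2 * \<sigma>\<^sup>2 * dotp p u v < 1"
  shows "(\<integral>\<^sup>+z. ennreal ((\<Prod>i<n. row_lr p u (z i)) * (\<Prod>i<n. row_lr p v (z i))) \<partial>null_law n p \<sigma>)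
    = ennreal ((1 / sqrt (1 - 2 * \<sigma>\<^sup>2 * dotp p u v)) ^ n)"
proof -
  interpret N: prob_space "null_row p \<sigma>" by (rule prob_space_null_row[OF s])
  interpret P: product_sigma_finite "\<lambda>_::nat. null_row p \<sigma>"
    by (simp add: product_sigma_finite_def N.sigma_finite_measure_axioms)
  have "(\<integral>\<^sup>+z. ennreal ((\<Prod>i<n. row_lr p u (z i)) * (\<Prod>i<n. row_lr p v (z i))) \<partial>null_law n p \<sigma>)
      = (\<integral>\<^sup>+z. (\<Prod>i<n. ennreal (row_lr p u (z i) * row_lr p v (z i))) \<partial>null_law n p \<sigma>)"
    by (subst prod_ennreal) (auto simp: prod.distrib)
  also have "\<dots> = (\<Prod>i<n. ennreal (1 / sqrt (1 - 2 * \<sigma>\<^sup>2 * dotp p u v)))"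
    unfolding null_law_def
    by (subst P.product_nn_integral_prod) (auto simp: nn_integral_row_lr_product[OF s h])
  also have "\<dots> = ennreal ((1 / sqrt (1 - 2 * \<sigma>\<^sup>2 * dotp p u v)) ^ n)"
    using h by (simp add: ennreal_power)
  finally show ?thesis .
qed

lemma prob_space_law_spiked_param:
  assumes "0 < \<sigma>"
  shows "prob_space (law n p (spiked_param p \<sigma> u))"
proof -
  have pN: "prob_space (null_law n p \<sigma>)"
    unfolding null_law_def by (rule prob_space_PiM) (rule prob_space_null_row[OF assms])
  have sets: "sets (null_law n p \<sigma>) = sets (obs_space n p)"
    unfolding null_law_def obs_space_def by (rule sets_PiM_cong) auto
  have [measurable]: "(\<lambda>z. \<Prod>i<n. row_lr p u (z i)) \<in> borel_measurable (null_law n p \<sigma>)"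
    unfolding null_law_def by measurable
  show ?thesis
    unfolding law_spiked_param[OF assms]
  proof (rule prob_spaceI)
    have "emeasure (density (null_law n p \<sigma>) (\<lambda>z. ennreal (\<Prod>i<n. row_lr p u (z i)))) (space (null_law n p \<sigma>))
       = (\<integral>\<^sup>+z. ennreal (\<Prod>i<n. row_lr p u (z i)) * indicator (space (null_law n p \<sigma>)) z \<partial>null_law n p \<sigma>)"
      by (intro emeasure_density sets.top) measurable
    also have "\<dots> = (\<integral>\<^sup>+z. ennreal ((\<Prod>i<n. row_lr p u (z i)) * (\<Prod>i<n. row_lr p (\<lambda>_. 0) (z i))) \<partial>null_law n p \<sigma>)"
      by (rule nn_integral_cong) (simp add: row_lr_def dotp_def case_prod_unfold)
    also have "\<dots> = 1"
      by (subst nn_integral_lr_product[OF assms]) (simp_all add: dotp_def)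
    finally show "emeasure (density (null_law n p \<sigma>) (\<lambda>z. ennreal (\<Prod>i<n. row_lr p u (z i))))
       (space (density (null_law n p \<sigma>) (\<lambda>z. ennreal (\<Prod>i<n. row_lr p u (z i))))) = 1"
      by simp
  qed
qed

section \<open>From the second moment of a mixture to the length of intervals\<close>

text \<open>
  Let \<open>L\<close> be the average of the densities \<open>f i\<close>. Then \<open>L\<close> has mean \<open>1\<close> and second moment at most
  \<open>1 + \<epsilon>\<^sup>2\<close>, so \<open>L\<close> is close to \<open>1\<close> and an event that is rare under the mixture is rare under \<open>M\<close>.
  Instead of the inequality of Cauchy and Schwarz the linearized form
  \<open>1 - L \<le> \<epsilon> / 2 + (1 - L)\<^sup>2 / (2 \<epsilon>)\<close> is integrated, which gives the same constant.
\<close>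

lemma (in prob_space) mixture_second_moment_bound:
  fixes f :: "'i \<Rightarrow> 'a \<Rightarrow> real"
  assumes F: "finite F" "F \<noteq> {}" and \<epsilon>: "0 < \<epsilon>"
    and meas [measurable]: "\<And>i. i \<in> F \<Longrightarrow> f i \<in> borel_measurable M"
    and nonneg: "\<And>i x. 0 \<le> f i x"
    and one: "\<And>i. i \<in> F \<Longrightarrow> (\<integral>\<^sup>+x. ennreal (f i x) \<partial>M) = 1"
    and cross: "\<And>i j. i \<in> F \<Longrightarrow> j \<in> F \<Longrightarrow> (\<integral>\<^sup>+x. ennreal (f i x * f j x) \<partial>M) \<le> ennreal (V i j)"
    and V0: "\<And>i j. 0 \<le> V i j"
    and V: "(\<Sum>i\<in>F. \<Sum>j\<in>F. V i j) \<le> (1 + \<epsilon>\<^sup>2) * (real (card F))\<^sup>2"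
    and B [measurable]: "B \<in> sets M"
    and small: "\<And>i. i \<in> F \<Longrightarrow> measure (density M (\<lambda>x. ennreal (f i x))) B \<le> \<alpha>"
  shows "prob B \<le> \<alpha> + \<epsilon>"
proof -
  define N where "N = real (card F)"
  have N: "0 < N" using F by (simp add: N_def card_gt_0_iff)
  define L where "L x = (\<Sum>i\<in>F. f i x) / N" for x
  have int1: "integrable M (f i)" "(\<integral>x. f i x \<partial>M) = 1" if "i \<in> F" for i
  proof -
    show "integrable M (f i)"
      by (rule integrableI_nonneg) (use that one[OF that] nonneg in auto)
    show "(\<integral>x. f i x \<partial>M) = 1"
      by (subst integral_eq_nn_integral) (use that one[OF that] nonneg in auto)
  qed
  have int2: "integrable M (\<lambda>x. f i x * f j x)" "(\<integral>x. f i x * f j x \<partial>M) \<le> V i j" if "i \<in> F" "j \<in> F" for i j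
  proof -
    show "integrable M (\<lambda>x. f i x * f j x)"
      by (rule integrableI_nonneg) (use that cross[OF that] nonneg in \<open>auto simp: less_top[symmetric] top_unique\<close>)
    show "(\<integral>x. f i x * f j x \<partial>M) \<le> V i j"
      by (subst integral_eq_nn_integral)
         (use that cross[OF that] nonneg V0 in \<open>auto intro!: enn2real_leI\<close>)
  qed
  have L2: "(L x)\<^sup>2 = (\<Sum>i\<in>F. \<Sum>j\<in>F. f i x * f j x) / N\<^sup>2" for x
    by (simp add: L_def power_divide power2_eq_square sum_product)
  have intL: "integrable M L" and L1: "(\<integral>x. L x \<partial>M) = 1"
    unfolding L_def using int1 N by (auto simp: Bochner_Integration.integral_sum N_def)
  have intL2: "integrable M (\<lambda>x. (L x)\<^sup>2)"
    unfolding L2 using int2 by (intro integrable_divide Bochner_Integration.integrable_sum) auto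
  have "(\<integral>x. (L x)\<^sup>2 \<partial>M) = (\<Sum>i\<in>F. \<Sum>j\<in>F. \<integral>x. f i x * f j x \<partial>M) / N\<^sup>2"
    unfolding L2 using int2 by (simp add: Bochner_Integration.integral_sum)
  also have "\<dots> \<le> (\<Sum>i\<in>F. \<Sum>j\<in>F. V i j) / N\<^sup>2"
    by (intro divide_right_mono sum_mono int2) auto
  also have "\<dots> \<le> 1 + \<epsilon>\<^sup>2"
    using V N by (simp add: N_def divide_le_eq)
  finally have L2le: "(\<integral>x. (L x)\<^sup>2 \<partial>M) \<le> 1 + \<epsilon>\<^sup>2" .
  have intB: "integrable M (\<lambda>x. f i x * indicator B x)" if "i \<in> F" for i
    using integrable_mult_indicator[OF B int1(1)[OF that]] by (simp add: mult.commute)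
  have dens: "(\<integral>x. f i x * indicator B x \<partial>M) \<le> \<alpha>" if "i \<in> F" for i
  proof -
    have "(\<integral>x. f i x * indicator B x \<partial>M) = enn2real (\<integral>\<^sup>+x. ennreal (f i x * indicator B x) \<partial>M)"
      by (rule integral_eq_nn_integral) (use that nonneg in auto)
    also have "(\<integral>\<^sup>+x. ennreal (f i x * indicator B x) \<partial>M) = emeasure (density M (\<lambda>x. ennreal (f i x))) B"
      by (subst emeasure_density) (use that nonneg in \<open>auto simp: ennreal_mult ennreal_indicator[symmetric]\<close>)
    finally show ?thesis using small[OF that] by (simp add: measure_def)
  qed
  have LB: "L x * indicator B x = (\<Sum>i\<in>F. f i x * indicator B x) / N" for x
    by (simp add: L_def sum_distrib_right)
  have intLB: "integrable M (\<lambda>x. L x * indicator B x)"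
    unfolding LB by (intro integrable_divide Bochner_Integration.integrable_sum intB)
  have "(\<integral>x. L x * indicator B x \<partial>M) = (\<Sum>i\<in>F. \<integral>x. f i x * indicator B x \<partial>M) / N"
    unfolding LB using intB by (simp add: Bochner_Integration.integral_sum)
  also have "\<dots> \<le> (\<Sum>i\<in>F. \<alpha>) / N"
    by (intro divide_right_mono sum_mono dens) (use N in auto)
  finally have LBle: "(\<integral>x. L x * indicator B x \<partial>M) \<le> \<alpha>" using N by (simp add: N_def)
  \<comment> \<open>The second summand is at least \<open>1 - L\<close> and nonnegative, so the sum dominates the indicator of \<open>B\<close>.\<close>
  let ?h = "\<lambda>x. L x * indicator B x + (\<epsilon> / 2 + ((L x)\<^sup>2 - 2 * L x + 1) / (2 * \<epsilon>))"
  have inth: "integrable M ?h" using intL intL2 intLB by auto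
  have "prob B = (\<integral>x. indicator B x \<partial>M)" by simp
  also have "\<dots> \<le> (\<integral>x. ?h x \<partial>M)"
  proof (rule integral_mono[OF _ inth])
    show "integrable M (indicator B :: 'a \<Rightarrow> real)" by (rule integrable_real_indicator) (auto simp: less_top[symmetric])
    fix x
    have "0 \<le> (\<epsilon> - (1 - L x))\<^sup>2" by simp
    then have "2 * \<epsilon> * (1 - L x) \<le> \<epsilon>\<^sup>2 + ((L x)\<^sup>2 - 2 * L x + 1)"
      by (simp add: power2_eq_square algebra_simps)
    then have *: "1 - L x \<le> \<epsilon> / 2 + ((L x)\<^sup>2 - 2 * L x + 1) / (2 * \<epsilon>)"
      using \<epsilon> by (simp add: field_simps power2_eq_square)
    have "0 \<le> (L x - 1)\<^sup>2" by simp
    then have "0 \<le> (L x)\<^sup>2 - 2 * L x + 1" by (simp add: power2_eq_square algebra_simps)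
    from divide_nonneg_pos[OF this, of "2 * \<epsilon>"]
    have "0 \<le> \<epsilon> / 2 + ((L x)\<^sup>2 - 2 * L x + 1) / (2 * \<epsilon>)"
      using \<epsilon> by simp
    with * show "indicator B x \<le> ?h x" by (auto simp: indicator_def)
  qed
  also have "\<dots> = (\<integral>x. L x * indicator B x \<partial>M) + (\<epsilon> / 2 + ((\<integral>x. (L x)\<^sup>2 \<partial>M) - 2 * 1 + 1) / (2 * \<epsilon>))"
    using intL intL2 intLB L1 by (simp add: prob_space)
  also have "\<dots> \<le> \<alpha> + (\<epsilon> / 2 + (1 + \<epsilon>\<^sup>2 - 2 * 1 + 1) / (2 * \<epsilon>))"
    using \<epsilon> L2le LBle by (intro add_mono divide_right_mono) auto
  also have "\<dots> = \<alpha> + \<epsilon>" using \<epsilon> by (simp add: field_simps power2_eq_square)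
  finally show ?thesis .
qed

text \<open>
  Under each alternative the upper end of the interval lies below \<open>t\<close> with probability at most \<open>\<alpha>\<close>,
  hence under the null law with probability at most \<open>\<alpha> + \<epsilon>\<close>. The interval misses \<open>0\<close> with
  probability at most \<open>\<alpha>\<close> under the null law. Outside these two events it has length at least \<open>t\<close>. Only
  the inequality \<open>t \<le> T\<close> is asked of the alternatives, so the functional may vary among them.
\<close>

lemma expected_length_lower_bound:
  fixes f :: "'i \<Rightarrow> obs \<Rightarrow> real"
  assumes ci: "(l, u) \<in> conf_intervals n p \<alpha> \<Theta> T"
    and \<theta>0: "\<theta>0 \<in> \<Theta>" "T (fst \<theta>0) = 0" and P: "prob_space (law n p \<theta>0)"
    and \<theta>: "\<And>i. i \<in> F \<Longrightarrow> \<theta> i \<in> \<Theta>" "\<And>i. i \<in> F \<Longrightarrow> t \<le> T (fst (\<theta> i))"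
    and t: "0 \<le> t"
    and dens: "\<And>i. i \<in> F \<Longrightarrow> law n p (\<theta> i) = density (law n p \<theta>0) (\<lambda>z. ennreal (f i z))"
    and Q: "\<And>i. i \<in> F \<Longrightarrow> prob_space (law n p (\<theta> i))"
    and F: "finite F" "F \<noteq> {}" and \<epsilon>: "0 < \<epsilon>"
    and meas: "\<And>i. i \<in> F \<Longrightarrow> f i \<in> borel_measurable (obs_space n p)"
    and nonneg: "\<And>i x. 0 \<le> f i x"
    and cross: "\<And>i j. i \<in> F \<Longrightarrow> j \<in> F \<Longrightarrow>
       (\<integral>\<^sup>+z. ennreal (f i z * f j z) \<partial>law n p \<theta>0) \<le> ennreal (V i j)"
    and V0: "\<And>i j. 0 \<le> V i j"
    and V: "(\<Sum>i\<in>F. \<Sum>j\<in>F. V i j) \<le> (1 + \<epsilon>\<^sup>2) * (real (card F))\<^sup>2"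
  shows "ennreal (t * (1 - 2 * \<alpha> - \<epsilon>)) \<le> (\<integral>\<^sup>+z. ennreal (u z - l z) \<partial>law n p \<theta>0)"
proof -
  let ?P = "law n p \<theta>0"
  interpret P: prob_space ?P by (rule P)
  have sets_law: "sets (law n p \<theta>') = sets (obs_space n p)" for \<theta>'
    by (simp add: law_def split: prod.split)
  have space_law: "space (law n p \<theta>') = space (obs_space n p)" for \<theta>'
    using sets_law by (rule sets_eq_imp_space_eq)
  have [measurable]: "l \<in> borel_measurable (obs_space n p)" "u \<in> borel_measurable (obs_space n p)"
    and lu: "\<And>z. z \<in> space (obs_space n p) \<Longrightarrow> l z \<le> u z"
    and cov: "\<And>\<theta>'. \<theta>' \<in> \<Theta> \<Longrightarrow> 1 - \<alpha> \<le> measure (law n p \<theta>')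
        {z \<in> space (obs_space n p). l z \<le> T (fst \<theta>') \<and> T (fst \<theta>') \<le> u z}"
    using ci by (auto simp: conf_intervals_def)
  define B where "B = {z \<in> space (obs_space n p). u z < t}"
  define C where "C = {z \<in> space (obs_space n p). l z \<le> 0 \<and> 0 \<le> u z}"
  have Bm: "B \<in> sets (obs_space n p)" and Cm: "C \<in> sets (obs_space n p)"
    unfolding B_def C_def by measurable
  have PB: "P.prob B \<le> \<alpha> + \<epsilon>"
  proof (rule P.mixture_second_moment_bound[OF F \<epsilon>])
    fix i assume i: "i \<in> F"
    interpret Q: prob_space "law n p (\<theta> i)" by (rule Q[OF i])
    show "f i \<in> borel_measurable ?P"
      using meas[OF i] by (simp cong: measurable_cong_sets add: sets_law)
    then have fm: "(\<lambda>z. ennreal (f i z)) \<in> borel_measurable ?P" by simp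
    have "(\<integral>\<^sup>+x. ennreal (f i x) \<partial>?P) = emeasure (density ?P (\<lambda>z. ennreal (f i z))) (space ?P)"
      by (subst emeasure_density[OF fm sets.top]) (auto intro!: nn_integral_cong)
    also have "\<dots> = 1"
      using Q.emeasure_space_1 unfolding dens[OF i, symmetric] space_law .
    finally show "(\<integral>\<^sup>+x. ennreal (f i x) \<partial>?P) = 1" .
    let ?A = "{z \<in> space (obs_space n p). l z \<le> T (fst (\<theta> i)) \<and> T (fst (\<theta> i)) \<le> u z}"
    have A: "?A \<in> sets (obs_space n p)" by measurable
    \<comment> \<open>On the covering event the upper end is at least \<open>T\<close>, hence at least \<open>t\<close>: it is disjoint from \<open>B\<close>.\<close>
    have "Q.prob B + Q.prob ?A = Q.prob (B \<union> ?A)"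
      by (rule Q.finite_measure_Union[symmetric]) (use A Bm \<theta>(2)[OF i] in \<open>auto simp: sets_law B_def\<close>)
    also have "\<dots> \<le> 1" by (rule Q.prob_le_1)
    finally have "Q.prob B \<le> \<alpha>" using cov[OF \<theta>(1)[OF i]] by simp
    then show "measure (density ?P (\<lambda>z. ennreal (f i z))) B \<le> \<alpha>" unfolding dens[OF i] .
  qed (use Bm V V0 cross nonneg in \<open>auto simp: sets_law\<close>)
  have "1 - \<alpha> \<le> P.prob C" using cov[OF \<theta>0(1)] \<theta>0(2) by (simp add: C_def)
  also have "P.prob C \<le> P.prob (B \<union> (C - B))"
    by (rule P.finite_measure_mono) (use Bm Cm in \<open>auto simp: sets_law\<close>)
  also have "\<dots> \<le> P.prob B + P.prob (C - B)"
    by (rule measure_Un_le) (use Bm Cm in \<open>auto simp: sets_law\<close>)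
  finally have D: "1 - 2 * \<alpha> - \<epsilon> \<le> P.prob (C - B)" using PB by simp
  have "ennreal (t * (1 - 2 * \<alpha> - \<epsilon>)) \<le> ennreal (t * P.prob (C - B))"
    using D t by (intro ennreal_leI mult_left_mono) auto
  also have "\<dots> = ennreal t * emeasure ?P (C - B)"
    using t by (simp add: ennreal_mult P.emeasure_eq_measure)
  also have "\<dots> = (\<integral>\<^sup>+z. ennreal t * indicator (C - B) z \<partial>?P)"
    by (rule nn_integral_cmult_indicator[symmetric]) (use Bm Cm in \<open>auto simp: sets_law\<close>)
  also have "\<dots> \<le> (\<integral>\<^sup>+z. ennreal (u z - l z) \<partial>?P)"
  proof (rule nn_integral_mono)
    fix z
    show "ennreal t * indicator (C - B) z \<le> ennreal (u z - l z)"
      by (auto simp: indicator_def B_def C_def intro!: ennreal_leI)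
  qed
  finally show ?thesis .
qed

section \<open>Spikes on transversals of a block partition\<close>

text \<open>
  The moment generating function of the number of agreements of two independent uniform choices of one
  element out of \<open>b\<close> in each of \<open>m\<close> blocks, up to the factor \<open>b\<^sup>2\<^sup>m\<close>. It is a sum over functions of a
  product over blocks, hence the product of the sums over single blocks.
\<close>

lemma sum_power_agreements:
  fixes w :: real
  shows "(\<Sum>\<phi>\<in>{..<m} \<rightarrow>\<^sub>E {..<b}. \<Sum>\<psi>\<in>{..<m} \<rightarrow>\<^sub>E {..<b}. w ^ card {i. i < m \<and> \<phi> i = \<psi> i})
    = real b ^ m * (w + (real b - 1)) ^ m"
proof -
  have pw: "w ^ card {i. i < m \<and> \<phi> i = \<psi> i} = (\<Prod>i<m. if \<phi> i = \<psi> i then w else 1)" for \<phi> \<psi> :: "nat \<Rightarrow> nat"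
  proof -
    have "(\<Prod>i<m. if \<phi> i = \<psi> i then w else 1) = (\<Prod>i\<in>{i\<in>{..<m}. \<phi> i = \<psi> i}. w)"
      by (subst prod.inter_filter) auto
    then show ?thesis by simp
  qed
  have inner: "(\<Sum>\<psi>\<in>{..<m} \<rightarrow>\<^sub>E {..<b}. w ^ card {i. i < m \<and> \<phi> i = \<psi> i}) = (w + (real b - 1)) ^ m"
    if \<phi>: "\<phi> \<in> {..<m} \<rightarrow>\<^sub>E {..<b}" for \<phi>
  proof -
    have "(\<Sum>\<psi>\<in>{..<m} \<rightarrow>\<^sub>E {..<b}. w ^ card {i. i < m \<and> \<phi> i = \<psi> i})
        = (\<Prod>i<m. \<Sum>a<b. if \<phi> i = a then w else 1)"
      unfolding pw by (subst prod_sum_PiE) auto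
    also have "\<dots> = (\<Prod>i<m. w + (real b - 1))"
    proof (rule prod.cong)
      fix i assume "i \<in> {..<m}"
      then have i: "\<phi> i < b" using \<phi> by auto
      \<comment> \<open>Exactly one of the \<open>b\<close> choices agrees with \<open>\<phi> i\<close>.\<close>
      have "(\<Sum>a<b. if \<phi> i = a then w else 1) = (\<Sum>a<b. (if \<phi> i = a then w - 1 else 0) + 1)"
        by (rule sum.cong) auto
      also have "\<dots> = w + (real b - 1)"
        using i by (subst sum.distrib) simp
      finally show "(\<Sum>a<b. if \<phi> i = a then w else 1) = w + (real b - 1)" .
    qed simp
    finally show ?thesis by simp
  qed
  have "card ({..<m} \<rightarrow>\<^sub>E {..<b}) = b ^ m" by (simp add: card_PiE)
  then show ?thesis by (simp add: inner)
qed

text \<open>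
  The image under the enumeration \<open>e\<close> of a set that has exactly one element, at the offset \<open>\<phi> i\<close>, in
  each of the blocks \<open>{i * b..<i * b + b}\<close> for \<open>i < m\<close>.
\<close>

definition transversal :: "(nat \<Rightarrow> nat) \<Rightarrow> nat \<Rightarrow> nat \<Rightarrow> (nat \<Rightarrow> nat) \<Rightarrow> nat set" where
  "transversal e b m \<phi> = (\<lambda>i. e (i * b + \<phi> i)) ` {..<m}"

lemma transversal_block:
  fixes a b :: nat
  assumes "a < b" "a' < b" "i * b + a = i' * b + a'"
  shows "i = i' \<and> a = a'"
proof -
  have "(i * b + a) div b = i" "(i' * b + a') div b = i'" using assms(1,2) by auto
  with assms show ?thesis by auto
qed

lemma transversal_index_less:
  fixes b :: nat
  assumes "i < m" "a < b" "m * b \<le> q"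
  shows "i * b + a < q"
proof -
  have "i * b + a < (i + 1) * b" using assms(2) by simp
  also have "\<dots> \<le> m * b" using assms(1) by (intro mult_le_mono1) simp
  finally show ?thesis using assms(3) by simp
qed

lemma transversal_subset:
  assumes "\<phi> \<in> {..<m} \<rightarrow>\<^sub>E {..<b}" "m * b \<le> q"
  shows "transversal e b m \<phi> \<subseteq> e ` {..<q}"
proof
  fix x assume "x \<in> transversal e b m \<phi>"
  then obtain i where i: "i < m" "x = e (i * b + \<phi> i)" by (auto simp: transversal_def)
  then have "\<phi> i < b" using assms(1) by auto
  from transversal_index_less[OF i(1) this assms(2)] i(2) show "x \<in> e ` {..<q}" by blast
qed

lemma transversal_inj:
  fixes b :: nat
  assumes e: "inj_on e {..<q}" and mb: "m * b \<le> q"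
    and \<phi>: "\<phi> \<in> {..<m} \<rightarrow>\<^sub>E {..<b}" and \<psi>: "\<psi> \<in> {..<m} \<rightarrow>\<^sub>E {..<b}"
    and "i < m" "i' < m" "e (i * b + \<phi> i) = e (i' * b + \<psi> i')"
  shows "i = i' \<and> \<phi> i = \<psi> i'"
proof -
  have "\<phi> i < b" "\<psi> i' < b" using assms by auto
  moreover have "i * b + \<phi> i = i' * b + \<psi> i'"
    using transversal_index_less[OF \<open>i < m\<close> \<open>\<phi> i < b\<close> mb]
      transversal_index_less[OF \<open>i' < m\<close> \<open>\<psi> i' < b\<close> mb]
    by (intro inj_onD[OF e assms(7)]) auto
  ultimately show ?thesis by (rule transversal_block)
qed

text \<open>
  Distinct blocks are disjoint, so two transversals can only meet within a block.
\<close>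

lemma card_transversal_Int:
  assumes "inj_on e {..<q}" "m * b \<le> q"
    and \<phi>: "\<phi> \<in> {..<m} \<rightarrow>\<^sub>E {..<b}" and \<psi>: "\<psi> \<in> {..<m} \<rightarrow>\<^sub>E {..<b}"
  shows "card (transversal e b m \<phi> \<inter> transversal e b m \<psi>) = card {i. i < m \<and> \<phi> i = \<psi> i}"
proof -
  note inj = transversal_inj[OF assms(1,2)]
  have "transversal e b m \<phi> \<inter> transversal e b m \<psi> = (\<lambda>i. e (i * b + \<phi> i)) ` {i. i < m \<and> \<phi> i = \<psi> i}"
  proof (intro equalityI subsetI)
    fix x assume "x \<in> transversal e b m \<phi> \<inter> transversal e b m \<psi>"
    then obtain i i' where i: "i < m" "x = e (i * b + \<phi> i)" and i': "i' < m" "x = e (i' * b + \<psi> i')"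
      by (auto simp: transversal_def)
    have "e (i * b + \<phi> i) = e (i' * b + \<psi> i')" using i i' by simp
    from inj[OF \<phi> \<psi> i(1) i'(1) this] i show "x \<in> (\<lambda>i. e (i * b + \<phi> i)) ` {i. i < m \<and> \<phi> i = \<psi> i}"
      by auto
  next
    fix x assume "x \<in> (\<lambda>i. e (i * b + \<phi> i)) ` {i. i < m \<and> \<phi> i = \<psi> i}"
    then obtain i where i: "i < m" "\<phi> i = \<psi> i" "x = e (i * b + \<phi> i)" by auto
    then have "x = e (i * b + \<psi> i)" by simp
    with i show "x \<in> transversal e b m \<phi> \<inter> transversal e b m \<psi>"
      unfolding transversal_def by blast
  qed
  moreover have "inj_on (\<lambda>i. e (i * b + \<phi> i)) {i. i < m \<and> \<phi> i = \<psi> i}"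
    using inj[OF \<phi> \<phi>] by (auto intro!: inj_onI)
  ultimately show ?thesis by (simp only: card_image)
qed

lemma card_transversal:
  assumes "inj_on e {..<q}" "m * b \<le> q" "\<phi> \<in> {..<m} \<rightarrow>\<^sub>E {..<b}"
  shows "card (transversal e b m \<phi>) = m"
  using card_transversal_Int[OF assms(1,2,3,3)] by simp

text \<open>
  The signs follow \<open>\<xi>\<close>, so that all entries contribute to \<open>\<xi>\<^sup>T \<beta>\<close> with the same sign.
\<close>

definition spike :: "real \<Rightarrow> (nat \<Rightarrow> real) \<Rightarrow> nat set \<Rightarrow> nat \<Rightarrow> real" where
  "spike t \<xi> S j = (if j \<in> S then t * sgn (\<xi> j) else 0)"

lemma dotp_spike:
  assumes "S \<subseteq> supp p \<xi>" "S' \<subseteq> supp p \<xi>"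
  shows "dotp p (spike t \<xi> S) (spike t \<xi> S') = t\<^sup>2 * real (card (S \<inter> S'))"
proof -
  have "dotp p (spike t \<xi> S) (spike t \<xi> S') = (\<Sum>j<p. if j \<in> S \<inter> S' then t\<^sup>2 else 0)"
    unfolding dotp_def
  proof (rule sum.cong)
    fix j
    have "sgn (\<xi> j) * sgn (\<xi> j) = 1" if "j \<in> S" using that assms by (auto simp: supp_def sgn_if)
    then show "spike t \<xi> S j * spike t \<xi> S' j = (if j \<in> S \<inter> S' then t\<^sup>2 else 0)"
      by (auto simp: spike_def power2_eq_square)
  qed simp
  also have "\<dots> = (\<Sum>j\<in>{j\<in>{..<p}. j \<in> S \<inter> S'}. t\<^sup>2)"
    by (subst sum.inter_filter) auto
  also have "{j\<in>{..<p}. j \<in> S \<inter> S'} = S \<inter> S'" using assms by (auto simp: supp_def)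
  finally show ?thesis by simp
qed

lemma dotp_loading_spike:
  assumes "S \<subseteq> supp p \<xi>"
  shows "dotp p \<xi> (spike t \<xi> S) = t * (\<Sum>j\<in>S. \<bar>\<xi> j\<bar>)"
proof -
  have "dotp p \<xi> (spike t \<xi> S) = (\<Sum>j<p. if j \<in> S then t * \<bar>\<xi> j\<bar> else 0)"
    unfolding dotp_def by (rule sum.cong) (auto simp: spike_def sgn_if)
  also have "\<dots> = (\<Sum>j\<in>{j\<in>{..<p}. j \<in> S}. t * \<bar>\<xi> j\<bar>)"
    by (subst sum.inter_filter) auto
  also have "{j\<in>{..<p}. j \<in> S} = S" using assms by (auto simp: supp_def)
  finally show ?thesis by (simp add: sum_distrib_left)
qed

section \<open>The lower bound for dense loadings\<close>

lemma norm_inf_nonneg: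
  assumes "1 \<le> p"
  shows "0 \<le> norm_inf p \<xi>"
proof -
  have "0 \<le> \<bar>\<xi> 0\<bar>" by simp
  also have "\<dots> \<le> norm_inf p \<xi>" unfolding norm_inf_def by (rule Max_ge) (use assms in auto)
  finally show ?thesis .
qed

text \<open>
  The bounded ratio in the definition of the loadings makes all nonzero entries comparable to the
  largest one, so any choice of \<open>m\<close> of them yields a functional of order \<open>m \<parallel>\<xi>\<parallel>\<^sub>\<infinity>\<close>.
\<close>

lemma norm_inf_le_cbar_entry:
  assumes \<xi>: "\<xi> \<in> Xi p q cbar" and j: "j \<in> supp p \<xi>"
  shows "norm_inf p \<xi> \<le> cbar * \<bar>\<xi> j\<bar>"
proof -
  let ?A = "(\<lambda>j. \<bar>\<xi> j\<bar>) ` supp p \<xi>"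
  have fin: "finite ?A" and ne: "?A \<noteq> {}" using j by (auto simp: supp_def)
  have pos: "0 < Min ?A" using fin ne by (simp add: Min_gr_iff) (auto simp: supp_def)
  have "norm_inf p \<xi> \<le> Max ?A"
    unfolding norm_inf_def
  proof (rule Max.boundedI)
    fix a assume "a \<in> (\<lambda>j. \<bar>\<xi> j\<bar>) ` {..<p}"
    then obtain i where i: "i < p" "a = \<bar>\<xi> i\<bar>" by auto
    show "a \<le> Max ?A"
    proof (cases "\<xi> i = 0")
      case True
      have "0 \<le> \<bar>\<xi> j\<bar>" by simp
      also have "\<dots> \<le> Max ?A" by (rule Max_ge[OF fin]) (use j in auto)
      finally show ?thesis using True i by simp
    next
      case False
      then show ?thesis using i by (intro Max_ge[OF fin]) (auto simp: supp_def)
    qed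
  qed (use j in \<open>auto simp: supp_def\<close>)
  also have "Max ?A \<le> cbar * Min ?A"
    using \<xi> pos by (simp add: Xi_def divide_le_eq)
  also have "cbar * Min ?A \<le> cbar * \<bar>\<xi> j\<bar>"
  proof (rule mult_left_mono)
    show "Min ?A \<le> \<bar>\<xi> j\<bar>" by (rule Min_le[OF fin]) (use j in auto)
    have "Min ?A \<le> Max ?A" by (rule order.trans[OF Min_le[OF fin] Max_ge[OF fin]]) (use j in auto)
    then have "1 \<le> Max ?A / Min ?A" using pos by simp
    also have "\<dots> \<le> cbar" using \<xi> by (simp add: Xi_def)
    finally show "0 \<le> cbar" by simp
  qed
  finally show ?thesis .
qed

lemma Xi_card_supp: "\<xi> \<in> Xi p q cbar \<Longrightarrow> card (supp p \<xi>) = q"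
  by (simp add: Xi_def norm0_def)

lemma Xi_pos:
  assumes "\<xi> \<in> Xi p q cbar"
  shows "1 \<le> q"
proof -
  have "supp p \<xi> \<noteq> {}"
  proof
    assume "supp p \<xi> = {}"
    then have "\<xi> = (\<lambda>j\<in>{..<p}. 0)"
      using assms by (auto simp: Xi_def supp_def PiE_def extensional_def fun_eq_iff)
    then show False using assms by (simp add: Xi_def)
  qed
  moreover have "finite (supp p \<xi>)" by (simp add: supp_def)
  ultimately have "card (supp p \<xi>) > 0" by (simp add: card_gt_0_iff)
  then show ?thesis using Xi_card_supp[OF assms] by simp
qed

text \<open>
  Compares the second moment of \<open>n\<close> observations with an exponential of the overlap, since \<open>h\<close> will be
  proportional to the overlap.
\<close>

lemma recip_sqrt_power_le_exp:
  fixes h :: real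
  assumes "0 \<le> h" "h \<le> 1 / 4"
  shows "(1 / sqrt (1 - 2 * h)) ^ n \<le> exp (2 * h * real n)"
proof -
  have "- (2 * h) - 2 * (2 * h)\<^sup>2 \<le> ln (1 - 2 * h)"
    by (rule ln_one_minus_pos_lower_bound) (use assms in auto)
  moreover have "2 * (2 * h)\<^sup>2 \<le> 2 * h"
  proof -
    have "h * h \<le> h * (1 / 4)" using assms by (intro mult_left_mono) auto
    then show ?thesis by (simp add: power2_eq_square)
  qed
  ultimately have "- (4 * h) \<le> ln (1 - 2 * h)" by simp
  then have "exp (- (4 * h)) \<le> 1 - 2 * h" using assms by (subst (asm) ln_ge_iff) auto
  moreover have "(exp (- (2 * h)))\<^sup>2 = exp (- (4 * h))"
    by (simp add: power2_eq_square exp_add[symmetric])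
  ultimately have "exp (- (2 * h)) \<le> sqrt (1 - 2 * h)" by (intro real_le_rsqrt) simp
  then have "1 / sqrt (1 - 2 * h) \<le> 1 / exp (- (2 * h))"
    by (intro divide_left_mono) (use assms in auto)
  also have "\<dots> = exp (2 * h)" by (simp add: exp_minus field_simps)
  finally have "(1 / sqrt (1 - 2 * h)) ^ n \<le> exp (2 * h) ^ n"
    by (rule power_mono) (use assms in auto)
  then show ?thesis by (simp add: exp_of_nat_mult[symmetric] mult.commute)
qed

lemma agreement_moment_le:
  fixes w :: real
  assumes w: "1 \<le> w" and b: "1 \<le> b" and e: "exp (real m * (w - 1) / real b) \<le> B"
  shows "real b ^ m * (w + (real b - 1)) ^ m \<le> B * (real b ^ m)\<^sup>2"
proof -
  have "w + (real b - 1) = real b * (1 + (w - 1) / real b)" using b by (simp add: field_simps)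
  then have "(w + (real b - 1)) ^ m = real b ^ m * (1 + (w - 1) / real b) ^ m"
    by (simp add: power_mult_distrib)
  also have "(1 + (w - 1) / real b) ^ m \<le> exp ((w - 1) / real b) ^ m"
    using w by (intro power_mono exp_ge_add_one_self) auto
  also have "exp ((w - 1) / real b) ^ m = exp (real m * (w - 1) / real b)"
    by (simp add: exp_of_nat_mult[symmetric])
  finally have "(w + (real b - 1)) ^ m \<le> real b ^ m * B" using e
    by (meson mult_left_mono order.trans zero_le_power of_nat_0_le_iff)
  then have "real b ^ m * (w + (real b - 1)) ^ m \<le> real b ^ m * (real b ^ m * B)"
    by (rule mult_left_mono) simp
  then show ?thesis by (simp add: power2_eq_square mult_ac)
qed

text \<open>
  The lower bound at fixed \<open>n\<close> and \<open>p\<close>. The constant \<open>a\<close> sets the size \<open>\<sigma>\<^sup>2 t\<^sup>2 = a log p / n\<close> of the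
  spikes. The bounds on \<open>a c\<close> keep \<open>\<kappa>\<close> at most \<open>M\<^sub>1\<close> and all overlaps small enough for the second
  moments to exist; the last assumption bounds the second moment of the mixture. With \<open>\<sigma> = M\<^sub>2\<close> all
  residual deviations are admissible, being at most \<open>\<sigma>\<close>.
\<close>

lemma L_star_lower_bound:
  fixes \<alpha> \<epsilon> M1 M2 a c cbar :: real
  assumes \<epsilon>: "0 < \<epsilon>" "2 * \<alpha> + 2 * \<epsilon> = 1" and M: "1 < M1" "0 < M2" and cbar: "1 \<le> cbar"
    and n: "1 \<le> n" and p: "2 \<le> p" and m: "1 \<le> m" "m \<le> k" "m * b \<le> q" "1 \<le> b"
    and \<xi>: "\<xi> \<in> Xi p q cbar"
    and a: "0 < a" "a * c \<le> M1 - 1" "a * c \<le> 1 / 4"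
    and k: "real k * ln (real p) \<le> c * real n"
    and mix: "exp (real m * (exp (2 * a * ln (real p)) - 1) / real b) \<le> 1 + \<epsilon>\<^sup>2"
  shows "ennreal (\<epsilon> * (M2 * sqrt a / (M1 * cbar)) * norm_inf p \<xi> * real m * sqrt (ln (real p) / real n))
     \<le> L_star n p \<alpha> (Theta p M1 M2 k1) (Theta p M1 M2 k) (\<lambda>\<beta>. dotp p \<xi> \<beta>)"
proof -
  define \<rho> where "\<rho> = a * ln (real p) / real n"
  have lnp: "0 < ln (real p)" using p by simp
  have \<rho>0: "0 < \<rho>" using a lnp n by (simp add: \<rho>_def)
  have \<rho>m: "\<rho> * real j \<le> a * c" if "j \<le> m" for j
  proof -
    have "real j * ln (real p) \<le> real k * ln (real p)"
      using that m(2) lnp by (intro mult_right_mono) auto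
    also have "\<dots> \<le> c * real n" by (rule k)
    finally have "a * (real j * ln (real p)) \<le> a * (c * real n)"
      using a by (intro mult_left_mono) auto
    then show ?thesis using n by (simp add: \<rho>_def field_simps)
  qed
  define t where "t = sqrt \<rho> / M2"
  have t0: "0 < t" using \<rho>0 M by (simp add: t_def)
  have t2: "M2\<^sup>2 * t\<^sup>2 = \<rho>" using \<rho>0 M by (simp add: t_def power_divide)
  have fin: "finite (supp p \<xi>)" by (simp add: supp_def)
  obtain e where e: "bij_betw e {..<q} (supp p \<xi>)"
    using ex_bij_betw_nat_finite[OF fin] Xi_card_supp[OF \<xi>] by (auto simp: atLeast0LessThan)
  have einj: "inj_on e {..<q}" and eimg: "e ` {..<q} = supp p \<xi>"
    using e by (auto simp: bij_betw_def)
  define F where "F = {..<m} \<rightarrow>\<^sub>E {..<b}"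
  define S where "S \<phi> = transversal e b m \<phi>" for \<phi>
  define u where "u \<phi> = spike t \<xi> (S \<phi>)" for \<phi>
  define \<theta> where "\<theta> \<phi> = spiked_param p M2 (u \<phi>)" for \<phi>
  define \<theta>0 where "\<theta>0 = spiked_param p M2 (\<lambda>_. 0)"
  define J where "J \<phi> \<psi> = card {i. i < m \<and> \<phi> i = \<psi> i}" for \<phi> \<psi> :: "nat \<Rightarrow> nat"
  have finF: "finite F" and neF: "F \<noteq> {}" and cardF: "card F = b ^ m"
    using m by (auto simp: F_def finite_PiE card_PiE PiE_eq_empty_iff lessThan_empty_iff)
  have S: "S \<phi> \<subseteq> supp p \<xi>" if "\<phi> \<in> F" for \<phi>
    using transversal_subset[of \<phi> m b q e] that m eimg by (simp add: S_def F_def)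
  have cardS: "card (S \<phi>) = m" if "\<phi> \<in> F" for \<phi>
    using card_transversal[OF einj m(3)] that by (simp add: S_def F_def)
  have Jm: "J \<phi> \<psi> \<le> m" for \<phi> \<psi>
  proof -
    have "card {i. i < m \<and> \<phi> i = \<psi> i} \<le> card {..<m}" by (rule card_mono) auto
    then show ?thesis by (simp add: J_def)
  qed
  have uu: "M2\<^sup>2 * dotp p (u \<phi>) (u \<psi>) = \<rho> * real (J \<phi> \<psi>)" if "\<phi> \<in> F" "\<psi> \<in> F" for \<phi> \<psi>
  proof -
    have "card (S \<phi> \<inter> S \<psi>) = J \<phi> \<psi>"
      using card_transversal_Int[OF einj m(3)] that by (simp add: S_def F_def J_def)
    then show ?thesis
      using dotp_spike[OF S[OF that(1)] S[OF that(2)], of t] t2 by (simp add: u_def mult.assoc[symmetric])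
  qed
  have Jself: "J \<phi> \<phi> = m" for \<phi> by (simp add: J_def)
  have \<kappa>: "1 + M2\<^sup>2 * dotp p (u \<phi>) (u \<phi>) \<le> M1" if "\<phi> \<in> F" for \<phi>
    using uu[OF that that] \<rho>m[of m] a Jself[of \<phi>] by simp
  define T where "T = (\<lambda>\<beta>. dotp p \<xi> \<beta>)"
  have \<theta>F: "\<theta> \<phi> \<in> Theta p M1 M2 k" if "\<phi> \<in> F" for \<phi>
    unfolding \<theta>_def
  proof (rule spiked_param_in_Theta)
    have "{j. j < p \<and> u \<phi> j \<noteq> 0} \<subseteq> S \<phi>" by (auto simp: u_def spike_def)
    then have "card {j. j < p \<and> u \<phi> j \<noteq> 0} \<le> card (S \<phi>)"
      using S[OF that] fin by (intro card_mono) (auto intro: finite_subset)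
    then show "card {j. j < p \<and> u \<phi> j \<noteq> 0} \<le> k" using cardS[OF that] m by simp
  qed (use p M \<kappa>[OF that] in auto)
  have \<theta>0k: "\<theta>0 \<in> Theta p M1 M2 j" for j
    unfolding \<theta>0_def by (rule spiked_param_in_Theta) (use p M in \<open>auto simp: dotp_def\<close>)
  have T0: "T (fst \<theta>0) = 0" unfolding T_def \<theta>0_def dotp_spiked_param by (simp add: dotp_def)
  have ninf: "0 \<le> norm_inf p \<xi>" by (rule norm_inf_nonneg) (use p in simp)
  define s where "s = M2\<^sup>2 / M1 * (t * (real m * (norm_inf p \<xi> / cbar)))"
  have s0: "0 \<le> s" using M t0 ninf cbar by (simp add: s_def)
  have sT: "s \<le> T (fst (\<theta> \<phi>))" if "\<phi> \<in> F" for \<phi>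
  proof -
    have "real m * (norm_inf p \<xi> / cbar) = (\<Sum>j\<in>S \<phi>. norm_inf p \<xi> / cbar)"
      using cardS[OF that] by simp
    also have "\<dots> \<le> (\<Sum>j\<in>S \<phi>. \<bar>\<xi> j\<bar>)"
    proof (rule sum_mono)
      fix j assume "j \<in> S \<phi>"
      then have "norm_inf p \<xi> \<le> cbar * \<bar>\<xi> j\<bar>"
        using norm_inf_le_cbar_entry[OF \<xi>] S[OF that] by auto
      then show "norm_inf p \<xi> / cbar \<le> \<bar>\<xi> j\<bar>" using cbar by (simp add: divide_le_eq mult.commute)
    qed
    finally have 1: "t * (real m * (norm_inf p \<xi> / cbar)) \<le> t * (\<Sum>j\<in>S \<phi>. \<bar>\<xi> j\<bar>)"
      by (rule mult_left_mono) (use t0 in simp)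
    have "M2\<^sup>2 / M1 \<le> M2\<^sup>2 / (1 + M2\<^sup>2 * dotp p (u \<phi>) (u \<phi>))"
      using \<kappa>[OF that] kappa_pos[of M2 p "u \<phi>"] M by (intro divide_left_mono) auto
    then have "s \<le> M2\<^sup>2 / (1 + M2\<^sup>2 * dotp p (u \<phi>) (u \<phi>)) * (t * (\<Sum>j\<in>S \<phi>. \<bar>\<xi> j\<bar>))"
      unfolding s_def
    proof (rule mult_mono[OF _ 1])
      show "0 \<le> M2\<^sup>2 / (1 + M2\<^sup>2 * dotp p (u \<phi>) (u \<phi>))"
        using kappa_pos[of M2 p "u \<phi>"] by (intro divide_nonneg_pos) auto
      show "0 \<le> t * (real m * (norm_inf p \<xi> / cbar))" using t0 ninf cbar by simp
    qed
    then show ?thesis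
      unfolding T_def \<theta>_def dotp_spiked_param u_def using dotp_loading_spike[OF S[OF that], of t] by simp
  qed
  define f where "f \<phi> z = (\<Prod>i<n. row_lr p (u \<phi>) (z i))" for \<phi> and z :: obs
  \<comment> \<open>By the choice of \<open>t\<close>, each common index multiplies the second moment by at most \<open>p\<^sup>2\<^sup>a\<close>.\<close>
  define V where "V \<phi> \<psi> = exp (2 * a * ln (real p)) ^ J \<phi> \<psi>" for \<phi> \<psi>
  have law0: "law n p \<theta>0 = null_law n p M2" unfolding \<theta>0_def by (rule null_law_eq_law[OF M(2)])
  have len: "ennreal (s * (1 - 2 * \<alpha> - \<epsilon>)) \<le> (\<integral>\<^sup>+z. ennreal (h z - l z) \<partial>law n p \<theta>0)"
    if lh: "(l, h) \<in> conf_intervals n p \<alpha> (Theta p M1 M2 k) T" for l h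
  proof (rule expected_length_lower_bound[OF lh \<theta>0k T0 _ \<theta>F sT s0 _ _ finF neF \<epsilon>(1)])
    show "prob_space (law n p \<theta>0)" unfolding \<theta>0_def by (rule prob_space_law_spiked_param[OF M(2)])
    show "prob_space (law n p (\<theta> \<phi>))" for \<phi>
      unfolding \<theta>_def by (rule prob_space_law_spiked_param[OF M(2)])
    show "law n p (\<theta> \<phi>) = density (law n p \<theta>0) (\<lambda>z. ennreal (f \<phi> z))" for \<phi>
      unfolding law0 \<theta>_def f_def by (rule law_spiked_param[OF M(2)])
    show "f \<phi> \<in> borel_measurable (obs_space n p)" for \<phi>
      unfolding f_def obs_space_def by measurable
    show "0 \<le> f \<phi> z" for \<phi> z by (simp add: f_def prod_nonneg)
    show "0 \<le> V \<phi> \<psi>" for \<phi> \<psi> by (simp add: V_def)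
    show "(\<integral>\<^sup>+z. ennreal (f \<phi> z * f \<psi> z) \<partial>law n p \<theta>0) \<le> ennreal (V \<phi> \<psi>)"
      if "\<phi> \<in> F" "\<psi> \<in> F" for \<phi> \<psi>
    proof -
      define h where "h = \<rho> * real (J \<phi> \<psi>)"
      have h: "0 \<le> h" "h \<le> 1 / 4" using \<rho>0 \<rho>m[OF Jm, of \<phi> \<psi>] a by (auto simp: h_def)
      have uh: "2 * M2\<^sup>2 * dotp p (u \<phi>) (u \<psi>) = 2 * h" using uu[OF that] by (simp add: h_def)
      have "2 * h * real n = real (J \<phi> \<psi>) * (2 * a * ln (real p))"
        using n by (simp add: h_def \<rho>_def)
      then have "exp (2 * h * real n) = V \<phi> \<psi>"
        unfolding V_def by (simp only: exp_of_nat_mult)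
      with recip_sqrt_power_le_exp[OF h, of n] have "(1 / sqrt (1 - 2 * h)) ^ n \<le> V \<phi> \<psi>" by simp
      then show ?thesis
        unfolding law0 f_def
        by (subst nn_integral_lr_product[OF M(2)]) (use h in \<open>auto simp: uh intro!: ennreal_leI\<close>)
    qed
    have "(\<Sum>\<phi>\<in>F. \<Sum>\<psi>\<in>F. V \<phi> \<psi>)
        = real b ^ m * (exp (2 * a * ln (real p)) + (real b - 1)) ^ m"
      unfolding V_def J_def F_def by (rule sum_power_agreements)
    also have "\<dots> \<le> (1 + \<epsilon>\<^sup>2) * (real b ^ m)\<^sup>2"
      by (rule agreement_moment_le[OF _ m(4) mix]) (use a lnp in simp)
    finally show "(\<Sum>\<phi>\<in>F. \<Sum>\<psi>\<in>F. V \<phi> \<psi>) \<le> (1 + \<epsilon>\<^sup>2) * (real (card F))\<^sup>2"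
      by (simp add: cardF)
  qed
  have "M2\<^sup>2 * t = M2 * sqrt a * sqrt (ln (real p) / real n)"
    using M by (simp add: t_def \<rho>_def power2_eq_square real_sqrt_mult[symmetric])
  then have "s * \<epsilon> = \<epsilon> * (M2 * sqrt a / (M1 * cbar)) * norm_inf p \<xi> * real m * sqrt (ln (real p) / real n)"
    using M cbar by (simp add: s_def field_simps)
  moreover have "1 - 2 * \<alpha> - \<epsilon> = \<epsilon>" using \<epsilon> by simp
  ultimately have target: "ennreal (\<epsilon> * (M2 * sqrt a / (M1 * cbar)) * norm_inf p \<xi> * real m * sqrt (ln (real p) / real n))
      = ennreal (s * (1 - 2 * \<alpha> - \<epsilon>))" by simp
  show ?thesis
    unfolding target L_star_def T_def[symmetric]
  proof (rule INF_greatest, clarify)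
    fix l h assume lh: "(l, h) \<in> conf_intervals n p \<alpha> (Theta p M1 M2 k) T"
    have "ennreal (s * (1 - 2 * \<alpha> - \<epsilon>)) \<le> (\<integral>\<^sup>+z. ennreal (h z - l z) \<partial>law n p \<theta>0)" by (rule len[OF lh])
    also have "\<dots> \<le> (SUP \<theta>\<in>Theta p M1 M2 k1. \<integral>\<^sup>+z. ennreal (h z - l z) \<partial>law n p \<theta>)"
      by (rule SUP_upper) (rule \<theta>0k)
    finally show "ennreal (s * (1 - 2 * \<alpha> - \<epsilon>)) \<le> (SUP \<theta>\<in>Theta p M1 M2 k1. \<integral>\<^sup>+z. ennreal (h z - l z) \<partial>law n p \<theta>)" .
  qed
qed

text \<open>
  The bound vanishes linearly in \<open>a\<close> with the power of \<open>x\<close> held fixed. This is what allows one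
  choice of \<open>a\<close> for all \<open>p\<close>, instead of only for large \<open>p\<close>.
\<close>

lemma power_excess_bound:
  fixes a \<eta> x :: real
  assumes "0 < a" "0 < \<eta>" "2 * a \<le> \<eta> / 2" "1 \<le> x"
  shows "exp (2 * a * ln x) - 1 \<le> 4 * a / \<eta> * x powr \<eta>"
proof -
  define y where "y = 2 * a * ln x"
  have lnx: "0 \<le> ln x" using assms by simp
  have y: "0 \<le> y" using assms lnx by (simp add: y_def)
  have "1 - y \<le> exp (- y)" using exp_ge_add_one_self[of "- y"] by simp
  then have "(1 - y) * exp y \<le> exp (- y) * exp y" by (rule mult_right_mono) simp
  then have 1: "exp y - 1 \<le> y * exp y" by (simp add: exp_minus algebra_simps)
  have "exp y \<le> x powr (\<eta> / 2)"
  proof -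
    have "y \<le> \<eta> / 2 * ln x" unfolding y_def using assms lnx by (intro mult_right_mono) auto
    then show ?thesis using assms by (simp add: powr_def)
  qed
  moreover have "y \<le> 4 * a / \<eta> * x powr (\<eta> / 2)"
  proof -
    have "\<eta> / 2 * ln x \<le> exp (\<eta> / 2 * ln x)"
      using exp_ge_add_one_self[of "\<eta> / 2 * ln x"] by linarith
    then have "ln x \<le> 2 / \<eta> * x powr (\<eta> / 2)" using assms by (simp add: powr_def field_simps)
    then have "2 * a * ln x \<le> 2 * a * (2 / \<eta> * x powr (\<eta> / 2))"
      using assms by (intro mult_left_mono) auto
    then show ?thesis by (simp add: y_def)
  qed
  ultimately have "y * exp y \<le> 4 * a / \<eta> * x powr (\<eta> / 2) * x powr (\<eta> / 2)"
    using assms y by (intro mult_mono) auto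
  also have "\<dots> = 4 * a / \<eta> * x powr \<eta>" by (simp add: powr_add[symmetric] mult.assoc)
  finally show ?thesis using 1 by (simp add: y_def)
qed

theorem theorem5:
  fixes \<alpha> M1 M2 c \<gamma> cbar cq \<gamma>q :: real
  assumes "0 < \<alpha>" and "\<alpha> < 1 / 2"
    and "1 < M1" and "0 < M2"
    and "0 < c" and "0 \<le> \<gamma>" and "\<gamma> < 1 / 2"
    and "1 \<le> cbar" and "0 < cq" and "2 * \<gamma> < \<gamma>q" and "\<gamma>q \<le> 1"
  shows "\<exists>c1>0. \<forall>(n::nat)\<ge>1. \<forall>(p::nat)\<ge>2. \<forall>(k::nat) (k1::nat) \<xi>.
    k1 \<le> k \<longrightarrow> real k \<le> c * min (real p powr \<gamma>) (real n / ln (real p)) \<longrightarrow>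
    dense_loading p cbar cq \<gamma>q \<xi> \<longrightarrow>
    L_star n p \<alpha> (Theta p M1 M2 k1) (Theta p M1 M2 k) (\<lambda>\<beta>. dotp p \<xi> \<beta>)
      \<ge> ennreal (c1 * norm_inf p \<xi> * real k * sqrt (ln (real p) / real n))"
proof -
  define \<epsilon> where "\<epsilon> = (1 - 2 * \<alpha>) / 2"
  define \<eta> where "\<eta> = \<gamma>q - 2 * \<gamma>"
  define K where "K = 2 * c\<^sup>2 / cq"
  \<comment> \<open>If \<open>k > q\<close>, only \<open>q\<close> spikes fit into the support of \<open>\<xi>\<close>. As \<open>k \<le> k\<^sup>2 \<le> K q\<close>, this costs a factor \<open>D\<close> at most.\<close>
  define D where "D = max 1 K"
  \<comment> \<open>The first two bounds control the second moment of the mixture, the third keeps the precision matrix in the parameter space, the last one keeps the overlaps bounded.\<close>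
  define a where "a = min (min (\<eta> / 4) (\<eta> * ln (1 + \<epsilon>\<^sup>2) / (8 * K))) (min ((M1 - 1) / c) (1 / (4 * c)))"
  define c0 where "c0 = \<epsilon> * (M2 * sqrt a / (M1 * cbar))"
  have \<epsilon>: "0 < \<epsilon>" "2 * \<alpha> + 2 * \<epsilon> = 1" using assms by (auto simp: \<epsilon>_def field_simps)
  have \<eta>: "0 < \<eta>" using assms by (simp add: \<eta>_def)
  have K: "0 < K" using assms by (simp add: K_def)
  have a0: "0 < a" using \<eta> K \<epsilon> assms by (simp add: a_def add_pos_pos ln_gt_zero)
  have a1: "2 * a \<le> \<eta> / 2" unfolding a_def by linarith
  have "a \<le> \<eta> * ln (1 + \<epsilon>\<^sup>2) / (8 * K)" "a \<le> (M1 - 1) / c" "a \<le> 1 / (4 * c)"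
    unfolding a_def by linarith+
  then have a2: "8 * K * a / \<eta> \<le> ln (1 + \<epsilon>\<^sup>2)" and a3: "a * c \<le> M1 - 1" "a * c \<le> 1 / 4"
    using \<eta> K assms by (auto simp: field_simps)
  have D: "1 \<le> D" "K \<le> D" by (auto simp: D_def)
  have c0: "0 < c0" using \<epsilon> a0 assms by (simp add: c0_def)
  show ?thesis
  proof (intro exI[of _ "c0 / D"] conjI allI impI)
    show "0 < c0 / D" using c0 D by simp
    fix n p k k1 :: nat and \<xi>
    assume n: "1 \<le> n" and p: "2 \<le> p" and k1: "k1 \<le> k"
      and k: "real k \<le> c * min (real p powr \<gamma>) (real n / ln (real p))"
      and dense: "dense_loading p cbar cq \<gamma>q \<xi>"
    show "ennreal (c0 / D * norm_inf p \<xi> * real k * sqrt (ln (real p) / real n))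
      \<le> L_star n p \<alpha> (Theta p M1 M2 k1) (Theta p M1 M2 k) (\<lambda>\<beta>. dotp p \<xi> \<beta>)"
    proof (cases "k = 0")
      case True
      then show ?thesis by simp
    next
      case False
      have lnp: "0 < ln (real p)" using p by simp
      have "real k \<le> c * (real n / ln (real p))"
        using k assms by (intro order.trans[OF k] mult_left_mono) auto
      then have kn: "real k * ln (real p) \<le> c * real n" using lnp by (simp add: field_simps)
      have kp: "real k \<le> c * real p powr \<gamma>"
        using assms by (intro order.trans[OF k] mult_left_mono) auto
      obtain q where q: "\<bar>real q - cq * real p powr \<gamma>q\<bar> < 1" and \<xi>: "\<xi> \<in> Xi p q cbar"
        using dense by (auto simp: dense_loading_def)
      have q1: "1 \<le> q" by (rule Xi_pos[OF \<xi>])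
      \<comment> \<open>Rounding loses at most half of \<open>c\<^sub>q p\<close> to the power \<open>\<gamma>\<^sub>q\<close>: if this number is at most \<open>2\<close>, then \<open>q \<ge> 1\<close> suffices.\<close>
      have qlow: "cq * real p powr \<gamma>q / 2 \<le> real q"
        using q q1 by (cases "cq * real p powr \<gamma>q \<le> 2") auto
      have k2q: "(real k)\<^sup>2 \<le> K * real p powr (- \<eta>) * real q"
      proof -
        have "(real k)\<^sup>2 \<le> (c * real p powr \<gamma>)\<^sup>2" using kp by (intro power_mono) auto
        also have "\<dots> = K * real p powr (- \<eta>) * (cq * real p powr \<gamma>q / 2)"
        proof -
          have "(real p powr \<gamma>)\<^sup>2 = real p powr (- \<eta>) * real p powr \<gamma>q"
            by (simp add: power2_eq_square powr_add[symmetric] \<eta>_def)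
          then show ?thesis using assms by (simp add: K_def power_mult_distrib)
        qed
        also have "\<dots> \<le> K * real p powr (- \<eta>) * real q"
          using qlow K by (intro mult_left_mono) auto
        finally show ?thesis .
      qed
      define m where "m = min k q"
      define b where "b = q div m"
      have m1: "1 \<le> m" using False q1 by (simp add: m_def)
      have mk: "m \<le> k" and mq: "m \<le> q" by (auto simp: m_def)
      have mb: "m * b \<le> q" by (simp add: b_def)
      have b1: "1 \<le> b" using mq m1 by (simp add: b_def div_greater_zero_iff Suc_le_eq)
      have kDm: "real k \<le> D * real m"
      proof (cases "k \<le> q")
        case True
        then show ?thesis using D by (simp add: m_def mult_le_cancel_right1)
      next
        case False
        have "real k * 1 \<le> (real k)\<^sup>2" using \<open>k \<noteq> 0\<close> unfolding power2_eq_square by (intro mult_left_mono) auto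
        also have "\<dots> \<le> K * real p powr (- \<eta>) * real q" by (rule k2q)
        also have "\<dots> \<le> K * 1 * real q"
        proof (intro mult_right_mono mult_left_mono)
          have "real p powr (- \<eta>) \<le> real p powr 0" using p \<eta> by (intro powr_mono) auto
          then show "real p powr (- \<eta>) \<le> 1" using p by simp
        qed (use K in auto)
        also have "\<dots> \<le> D * real q" using D by (simp add: mult_right_mono)
        finally show ?thesis using False by (simp add: m_def)
      qed
      have mb2: "real m / real b \<le> 2 * K * real p powr (- \<eta>)"
      proof -
        have "q < m * (b + 1)" using m1 mult_div_mod_eq[of m q] mod_less_divisor[of m q]
          unfolding b_def distrib_left by linarith
        also have "\<dots> \<le> m * (2 * b)" using b1 by (intro mult_le_mono2) simp
        finally have "real q \<le> real (m * (2 * b))" by (simp only: of_nat_le_iff less_imp_le)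
        then have "real q \<le> 2 * real m * real b" by simp
        then have "real m * real q \<le> real m * (2 * real m * real b)" by (rule mult_left_mono) simp
        then have "real m / real b * real q \<le> 2 * (real m)\<^sup>2"
          using b1 by (simp add: field_simps power2_eq_square)
        also have "\<dots> \<le> 2 * (real k)\<^sup>2" using mk by (simp add: power_mono)
        also have "\<dots> \<le> 2 * K * real p powr (- \<eta>) * real q" using k2q by simp
        finally show ?thesis by (rule mult_right_le_imp_le) (use q1 in simp)
      qed
      have w: "exp (2 * a * ln (real p)) - 1 \<le> 4 * a / \<eta> * real p powr \<eta>"
        by (rule power_excess_bound[OF a0 \<eta> a1]) (use p in simp)
      have "real m * (exp (2 * a * ln (real p)) - 1) / real b
          = real m / real b * (exp (2 * a * ln (real p)) - 1)" by simp
      also have "\<dots> \<le> (2 * K * real p powr (- \<eta>)) * (4 * a / \<eta> * real p powr \<eta>)"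
        using mb2 w K a0 lnp by (intro mult_mono) auto
      also have "\<dots> = 8 * K * a / \<eta> * (real p powr (- \<eta>) * real p powr \<eta>)" by simp
      also have "real p powr (- \<eta>) * real p powr \<eta> = 1"
        using p by (simp add: powr_add[symmetric])
      also have "8 * K * a / \<eta> * 1 \<le> ln (1 + \<epsilon>\<^sup>2)" using a2 by simp
      finally have "exp (real m * (exp (2 * a * ln (real p)) - 1) / real b) \<le> exp (ln (1 + \<epsilon>\<^sup>2))"
        by simp
      then have mix: "exp (real m * (exp (2 * a * ln (real p)) - 1) / real b) \<le> 1 + \<epsilon>\<^sup>2"
        using \<epsilon> by (simp add: add_pos_pos)
      have ninf: "0 \<le> norm_inf p \<xi>" by (rule norm_inf_nonneg) (use p in simp)
      have "c0 / D * real k \<le> c0 * real m"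
      proof -
        have "c0 * real k \<le> c0 * (D * real m)" using kDm c0 by (intro mult_left_mono) auto
        then show ?thesis using D by (simp add: field_simps)
      qed
      then have "c0 / D * real k * (norm_inf p \<xi> * sqrt (ln (real p) / real n))
          \<le> c0 * real m * (norm_inf p \<xi> * sqrt (ln (real p) / real n))"
        using ninf lnp by (intro mult_right_mono) auto
      then have "ennreal (c0 / D * norm_inf p \<xi> * real k * sqrt (ln (real p) / real n))
          \<le> ennreal (c0 * norm_inf p \<xi> * real m * sqrt (ln (real p) / real n))"
        by (intro ennreal_leI) (simp only: mult_ac)
      also have "\<dots> \<le> L_star n p \<alpha> (Theta p M1 M2 k1) (Theta p M1 M2 k) (\<lambda>\<beta>. dotp p \<xi> \<beta>)"
        unfolding c0_def
        by (rule L_star_lower_bound[OF \<epsilon> assms(3,4,8) n p m1 mk mb b1 \<xi> a0 a3 kn mix])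
      finally show ?thesis .
    qed
  qed
qed

end
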